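(* Let $\lambda>0$, $q\in(0,1)$, let $N\ge1$ be an integer, and let $M>0$. The functional $\mathcal F$ is bounded from below on the set of nonnegative functions $\rho\in L^1\cap L^q(\mathbb R^N)$ with $\int_{\mathbb R^N}\rho\,dx=M$ if and only if $q>N/(N+\lambda)$. Moreover, whenever the parameters $(N,\lambda,q)$ are such that the infimum $\mathcal C_{N,\lambda,q}$ is attained, if $\rho_*$ is a function attaining it, with $\int_{\mathbb R^N}\rho_*\,dx=M$, then there is $\tau>0$ such that the rescaled function $\rho_{*,\tau}(x):=\tau^N\rho_*(\tau x)$ (which has the same mass $M$) satisfies $\mathcal F[\rho]\ge\mathcal F[\rho_{*,\tau}]$ for every nonnegative $\rho\in L^1\cap L^q(\mathbb R^N)$ with $\int_{\mathbb R^N}\rho\,dx=M$.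
   Context: For $p>0$, $\rho\in L^p(\mathbb R^N)$ means that $\rho$ is measurable and $\int_{\mathbb R^N}|\rho|^p\,dx<\infty$ (also when $p<1$). For measurable $\rho\ge0$, $I_\lambda[\rho]:=\iint_{\mathbb R^N\times\mathbb R^N}\rho(x)|x-y|^\lambda\rho(y)\,dx\,dy\in[0,+\infty]$. The free energy is $$\mathcal F[\rho]:=\frac1{2\lambda}I_\lambda[\rho]-\frac1{1-q}\int_{\mathbb R^N}\rho^q\,dx .$$ With $\alpha:=\frac{2N-q(2N+\lambda)}{N(1-q)}$, $$\mathcal C_{N,\lambda,q}:=\inf\left\{\frac{I_\lambda[\rho]}{\left(\int_{\mathbb R^N}\rho\,dx\right)^{\alpha}\left(\int_{\mathbb R^N}\rho^q\,dx\right)^{(2-\alpha)/q}}:\ 0\le\rho\in L^1\cap L^q(\mathbb R^N),\ \rho\not\equiv0\right\}.$$ *)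

theory Defs
  imports "HOL-Analysis.Analysis"
begin

text \<open>Functions are honest functions \<^typ>\<open>real ^ 'n \<Rightarrow> real\<close>, Lebesgue measurable, and not classes
  modulo null sets.\<close>

definition Lp_fun :: "real \<Rightarrow> (real ^ 'n \<Rightarrow> real) set" where
  "Lp_fun p = {\<rho>. \<rho> \<in> borel_measurable lebesgue \<and>
                  (\<integral>\<^sup>+ x. ennreal (\<bar>\<rho> x\<bar> powr p) \<partial>lebesgue) < \<infinity>}"

definition I_energy :: "real \<Rightarrow> (real ^ 'n \<Rightarrow> real) \<Rightarrow> ennreal" where
  "I_energy lam \<rho> =
     (\<integral>\<^sup>+ (x, y). ennreal (\<rho> x * norm (x - y) powr lam * \<rho> y) \<partial>(lebesgue \<Otimes>\<^sub>M lebesgue))"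

definition nonneg_L1_Lq :: "real \<Rightarrow> (real ^ 'n \<Rightarrow> real) set" where
  "nonneg_L1_Lq q = {\<rho> \<in> Lp_fun 1 \<inter> Lp_fun q. \<forall>x. 0 \<le> \<rho> x}"

definition densities :: "real \<Rightarrow> real \<Rightarrow> (real ^ 'n \<Rightarrow> real) set" where
  "densities q M = {\<rho> \<in> nonneg_L1_Lq q. (LINT x|lebesgue. \<rho> x) = M}"

text \<open>The free energy may be \<open>+\<infinity>\<close>.  On \<^const>\<open>nonneg_L1_Lq\<close> the subtracted term is finite, so no
  indeterminate difference occurs there.\<close>

definition free_energy :: "real \<Rightarrow> real \<Rightarrow> (real ^ 'n \<Rightarrow> real) \<Rightarrow> ereal" where
  "free_energy lam q \<rho> =
     ereal (1 / (2 * lam)) * enn2ereal (I_energy lam \<rho>)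
       - ereal (1 / (1 - q) * (LINT x|lebesgue. \<rho> x powr q))"

definition HLS_exponent :: "nat \<Rightarrow> real \<Rightarrow> real \<Rightarrow> real" where
  "HLS_exponent N lam q = (2 * real N - q * (2 * real N + lam)) / (real N * (1 - q))"

definition HLS_quotient :: "real \<Rightarrow> real \<Rightarrow> (real ^ 'n \<Rightarrow> real) \<Rightarrow> ennreal" where
  "HLS_quotient lam q \<rho> =
     (let \<alpha> = HLS_exponent CARD('n) lam q in
      I_energy lam \<rho> /
        ennreal ((LINT x|lebesgue. \<rho> x) powr \<alpha>
                 * (LINT x|lebesgue. \<rho> x powr q) powr ((2 - \<alpha>) / q)))"

text \<open>Nonzero means not almost everywhere zero; both integrals in the denominator are then positive
  and finite.\<close>

definition HLS_admissible :: "real \<Rightarrow> (real ^ 'n \<Rightarrow> real) set" where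
  "HLS_admissible q = {\<rho> \<in> nonneg_L1_Lq q. \<not> (AE x in lebesgue. \<rho> x = 0)}"

definition HLS_const :: "'n::finite itself \<Rightarrow> real \<Rightarrow> real \<Rightarrow> ennreal" where
  "HLS_const _ lam q = (INF \<rho> \<in> (HLS_admissible q :: (real ^ 'n \<Rightarrow> real) set). HLS_quotient lam q \<rho>)"

definition attains_HLS_const :: "real \<Rightarrow> real \<Rightarrow> (real ^ 'n \<Rightarrow> real) \<Rightarrow> bool" where
  "attains_HLS_const lam q \<rho> \<longleftrightarrow>
     \<rho> \<in> HLS_admissible q \<and> HLS_quotient lam q \<rho> = HLS_const TYPE('n) lam q"

definition rescale :: "real \<Rightarrow> (real ^ 'n \<Rightarrow> real) \<Rightarrow> real ^ 'n \<Rightarrow> real" where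
  "rescale \<tau> \<rho> = (\<lambda>x. \<tau> ^ CARD('n) * \<rho> (\<tau> *\<^sub>R x))"

text \<open>The lower bound must be a real number: every set of extended reals is bounded below by \<open>-\<infinity>\<close>.\<close>

definition bounded_from_below_on :: "('a \<Rightarrow> ereal) \<Rightarrow> 'a set \<Rightarrow> bool" where
  "bounded_from_below_on F A \<longleftrightarrow> (\<exists>c::real. \<forall>a\<in>A. ereal c \<le> F a)"

end

theory Submission
  imports Defs
begin

text \<open>Some point \<open>a\<close> has potential \<open>\<integral> |a - y|\<^sup>\<lambda> \<rho>(y) dy \<le> (I + 1) / M\<close>. Against the weight
  \<open>w = 1 + |x - a|\<^sup>\<lambda>\<close>, Young's inequality \<open>\<rho>\<^sup>q \<le> q \<epsilon> w \<rho> + (1 - q) (\<epsilon> w)\<^bsup>-q/(1-q)\<^esup>\<close> bounds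
  \<open>\<integral> \<rho>\<^sup>q\<close> by an arbitrarily small multiple of \<open>I\<close> plus a constant, since \<open>w\<^bsup>-q/(1-q)\<^esup>\<close> is integrable exactly
  when \<open>q > N/(N+\<lambda>)\<close>. If \<open>q \<le> N/(N+\<lambda>)\<close>, averages over \<open>k < n\<close> of multiples of
  \<open>2\<^bsup>-k(N+\<lambda>)\<^esup> 1\<^bsub>B(0, 2\<^sup>k)\<^esub>\<close> keep mass and \<open>\<lambda>\<close>-moment bounded while \<open>\<integral> \<rho>\<^sup>q\<close> grows like
  \<open>n\<^bsup>1-q\<^esup>\<close>; this also forces \<open>\<C> = 0\<close>, which is never attained because \<open>I > 0\<close>. So an optimiser
  exists only for \<open>q > N/(N+\<lambda>)\<close>, where \<open>\<beta> = (2 - \<alpha>)/q = \<lambda>/(N(1-q)) > 1\<close>. With \<open>t\<close> the ratio of \<open>\<integral> \<rho>\<^sup>q\<close> to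
  its value at the optimiser, \<open>\<F>[\<rho>] \<ge> A t\<^sup>\<beta> - B t\<close>, with equality along the rescalings of the optimiser; the
  rescaling whose \<open>t\<close> minimises the right-hand side is the minimiser.\<close>

section \<open>Lebesgue measure: sigma-finiteness, balls and dilations\<close>

text \<open>The energy is an integral over a product of two completed measures, so Tonelli requires
  sigma-finiteness of the completion. The countable cover for \<open>lborel\<close> serves, since
  completion does not change the measure of Borel sets.\<close>

lemma sigma_finite_lebesgue: "sigma_finite_measure (lebesgue :: 'a::euclidean_space measure)"
proof -
  obtain A :: "'a set set"
    where "countable A" "A \<subseteq> sets lborel" "\<Union>A = space lborel" "\<forall>a\<in>A. emeasure lborel a \<noteq> \<infinity>"
    using lborel.sigma_finite_countable by blast
  then show ?thesis
    by unfold_locales (force intro!: exI[of _ A])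
qed

interpretation lebesgue: sigma_finite_measure "lebesgue :: 'a::euclidean_space measure"
  by (rule sigma_finite_lebesgue)

lemma emeasure_lebesgue_ball:
  "emeasure lebesgue (ball (a::real^'n) r) = ennreal (unit_ball_vol CARD('n) * r ^ CARD('n))" if "0 \<le> r"
  using emeasure_ball[of r a] that by simp

lemma nn_integral_lebesgue_scale:
  fixes f :: "real^'n \<Rightarrow> ennreal"
  assumes t: "0 < t" and f: "f \<in> borel_measurable lebesgue"
  shows "(\<integral>\<^sup>+x. f (t *\<^sub>R x) \<partial>lebesgue) = ennreal (t powr (- real CARD('n))) * (\<integral>\<^sup>+x. f x \<partial>lebesgue)"
    and "(\<lambda>x. f (t *\<^sub>R x)) \<in> borel_measurable lebesgue"
proof -
  \<comment> \<open>\<open>T\<close> is the dilation by \<open>t\<close> in the coordinate form of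
    \<open>lebesgue_affine_euclidean\<close>, with translation part 0; its density factor is
    \<open>t\<close> to the power N.\<close>
  define T where "T = (\<lambda>x::real^'n. 0 + (\<Sum>j\<in>Basis. (t * (x \<bullet> j)) *\<^sub>R j))"
  have T: "T = (\<lambda>x. t *\<^sub>R x)"
    by (auto simp: T_def euclidean_representation simp flip: scaleR_scaleR scaleR_sum_right)
  have meas: "T \<in> lebesgue \<rightarrow>\<^sub>M lebesgue"
    unfolding T_def by (rule lebesgue_affine_measurable) (use t in auto)
  show m: "(\<lambda>x. f (t *\<^sub>R x)) \<in> borel_measurable lebesgue"
    using measurable_compose[OF meas f] by (simp add: T)
  have c: "(\<Prod>j\<in>(Basis::(real^'n) set). \<bar>t\<bar>) = t powr real CARD('n)"
    using t by (simp add: powr_realpow)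
  have "lebesgue = density (distr lebesgue lebesgue T) (\<lambda>_. \<Prod>j\<in>(Basis::(real^'n) set). \<bar>t\<bar>)"
    unfolding T_def using lebesgue_affine_euclidean[of "\<lambda>_::real^'n. t" "0::real^'n"] t by simp
  then have "(\<integral>\<^sup>+x. f x \<partial>lebesgue) = (\<integral>\<^sup>+x. f x \<partial>density (distr lebesgue lebesgue T) (\<lambda>_. ennreal (t powr real CARD('n))))"
    unfolding c by simp
  also have "\<dots> = (\<integral>\<^sup>+x. ennreal (t powr real CARD('n)) * f x \<partial>distr lebesgue lebesgue T)"
    by (rule nn_integral_density) (use f in auto)
  also have "\<dots> = (\<integral>\<^sup>+x. ennreal (t powr real CARD('n)) * f (T x) \<partial>lebesgue)"
    by (rule nn_integral_distr[OF meas]) (use f in auto)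
  also have "\<dots> = ennreal (t powr real CARD('n)) * (\<integral>\<^sup>+x. f (t *\<^sub>R x) \<partial>lebesgue)"
    using m by (simp add: T nn_integral_cmult)
  finally have e: "(\<integral>\<^sup>+x. f x \<partial>lebesgue) = ennreal (t powr real CARD('n)) * (\<integral>\<^sup>+x. f (t *\<^sub>R x) \<partial>lebesgue)" .
  have "ennreal (t powr (- real CARD('n))) * ennreal (t powr real CARD('n)) = 1"
    using t by (simp flip: ennreal_mult powr_add)
  then show "(\<integral>\<^sup>+x. f (t *\<^sub>R x) \<partial>lebesgue) = ennreal (t powr (- real CARD('n))) * (\<integral>\<^sup>+x. f x \<partial>lebesgue)"
    unfolding e by (simp flip: mult.assoc)
qed

section \<open>The interaction energy as an iterated integral\<close>

text \<open>The identity is measurable from \<open>lebesgue\<close> to \<open>borel\<close>, so both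
  projections of the product are Borel-valued and the kernel is a Borel function of them.\<close>

lemma measurable_norm_diff_powr [measurable]:
  "(\<lambda>(x, y). ennreal (norm (x - y) powr l)) \<in>
     borel_measurable ((lebesgue :: (real^'n) measure) \<Otimes>\<^sub>M lebesgue)"
proof -
  have id: "(\<lambda>x::real^'n. x) \<in> lebesgue \<rightarrow>\<^sub>M borel"
    by (simp add: measurable_completion)
  have [measurable]: "fst \<in> (lebesgue :: (real^'n) measure) \<Otimes>\<^sub>M lebesgue \<rightarrow>\<^sub>M (borel :: (real^'n) measure)"
     "snd \<in> (lebesgue :: (real^'n) measure) \<Otimes>\<^sub>M lebesgue \<rightarrow>\<^sub>M (borel :: (real^'n) measure)"
    using measurable_compose[OF measurable_fst id] measurable_compose[OF measurable_snd id] by auto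
  show ?thesis unfolding case_prod_beta by measurable
qed

lemma measurable_lebesgue_norm_powr [measurable]:
  "(\<lambda>x. norm (x - a :: real^'n) powr l) \<in> borel_measurable lebesgue"
  by (intro measurable_completion) measurable

text \<open>Lets the estimates be made with \<open>ennreal\<close> integrals, where no integrability
  has to be checked, and be read off afterwards for the Bochner integrals in the
  definitions.\<close>

lemma nonneg_L1_LqD:
  assumes "\<rho> \<in> nonneg_L1_Lq q"
  shows "\<rho> \<in> borel_measurable lebesgue" "\<And>x. 0 \<le> \<rho> x"
    "(\<integral>\<^sup>+x. ennreal (\<rho> x) \<partial>lebesgue) = ennreal (LINT x|lebesgue. \<rho> x)"
    "(\<integral>\<^sup>+x. ennreal (\<rho> x powr q) \<partial>lebesgue) = ennreal (LINT x|lebesgue. \<rho> x powr q)"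
proof -
  show m[measurable]: "\<rho> \<in> borel_measurable lebesgue" and nn: "\<And>x. 0 \<le> \<rho> x"
    using assms by (auto simp: nonneg_L1_Lq_def Lp_fun_def)
  have f: "(\<integral>\<^sup>+x. ennreal (\<rho> x) \<partial>lebesgue) < \<infinity>" "(\<integral>\<^sup>+x. ennreal (\<rho> x powr q) \<partial>lebesgue) < \<infinity>"
    using assms nn by (simp_all add: nonneg_L1_Lq_def Lp_fun_def)
  show "(\<integral>\<^sup>+x. ennreal (\<rho> x) \<partial>lebesgue) = ennreal (LINT x|lebesgue. \<rho> x)"
    by (intro nn_integral_eq_integral integrableI_nonneg) (use nn f in auto)
  show "(\<integral>\<^sup>+x. ennreal (\<rho> x powr q) \<partial>lebesgue) = ennreal (LINT x|lebesgue. \<rho> x powr q)"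
    by (intro nn_integral_eq_integral integrableI_nonneg) (use f in auto)
qed

text \<open>Tonelli, arranged so that the inner integral is the potential of \<open>\<rho>\<close>
  at \<open>x\<close>.\<close>

lemma I_energy_iterated:
  fixes \<rho> :: "real^'n \<Rightarrow> real"
  assumes [measurable]: "\<rho> \<in> borel_measurable lebesgue" and nn: "\<And>x. 0 \<le> \<rho> x"
  shows "I_energy l \<rho> = (\<integral>\<^sup>+x. ennreal (\<rho> x) * (\<integral>\<^sup>+y. ennreal (norm (x - y) powr l * \<rho> y) \<partial>lebesgue) \<partial>lebesgue)"
proof -
  have e: "(\<lambda>(x, y). ennreal (\<rho> x * norm (x - y) powr l * \<rho> y)) =
      (\<lambda>(x, y). ennreal (\<rho> x) * (ennreal (norm (x - y) powr l) * ennreal (\<rho> y)))"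
    using nn by (auto simp: fun_eq_iff ennreal_mult mult.assoc)
  have [measurable]: "(\<lambda>(x, y). ennreal (\<rho> x * norm (x - y) powr l * \<rho> y)) \<in> borel_measurable (lebesgue \<Otimes>\<^sub>M lebesgue)"
    unfolding e case_prod_beta using measurable_norm_diff_powr[unfolded case_prod_beta] by measurable
  show ?thesis
    unfolding I_energy_def
  proof (subst lebesgue.nn_integral_fst[symmetric], simp, intro nn_integral_cong)
    fix x
    have "(\<integral>\<^sup>+y. (case (x, y) of (x, y) \<Rightarrow> ennreal (\<rho> x * norm (x - y) powr l * \<rho> y)) \<partial>lebesgue)
       = (\<integral>\<^sup>+y. ennreal (\<rho> x) * ennreal (norm (y - x) powr l * \<rho> y) \<partial>lebesgue)"
      using nn by (intro nn_integral_cong) (simp add: ennreal_mult mult.assoc norm_minus_commute)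
    also have "\<dots> = ennreal (\<rho> x) * (\<integral>\<^sup>+y. ennreal (norm (y - x) powr l * \<rho> y) \<partial>lebesgue)"
      by (rule nn_integral_cmult) measurable
    finally show "(\<integral>\<^sup>+y. (case (x, y) of (x, y) \<Rightarrow> ennreal (\<rho> x * norm (x - y) powr l * \<rho> y)) \<partial>lebesgue)
       = ennreal (\<rho> x) * (\<integral>\<^sup>+y. ennreal (norm (x - y) powr l * \<rho> y) \<partial>lebesgue)"
      by (simp add: norm_minus_commute)
  qed
qed

lemma measurable_potential [measurable]:
  fixes \<rho> :: "real^'n \<Rightarrow> real"
  assumes [measurable]: "\<rho> \<in> borel_measurable lebesgue" and nn: "\<And>x. 0 \<le> \<rho> x"
  shows "(\<lambda>x. \<integral>\<^sup>+y. ennreal (norm (x - y) powr l * \<rho> y) \<partial>lebesgue) \<in> borel_measurable lebesgue"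
proof (rule lebesgue.borel_measurable_nn_integral)
  show "(\<lambda>(x, y). ennreal (norm (x - y) powr l * \<rho> y)) \<in> borel_measurable (lebesgue \<Otimes>\<^sub>M lebesgue)"
    unfolding case_prod_beta ennreal_mult'[OF powr_ge_zero] 
    using measurable_norm_diff_powr[unfolded case_prod_beta] by measurable
qed

text \<open>If the energy vanished, the potential would vanish at some \<open>x\<close> with
  \<open>\<rho> x \<noteq> 0\<close>. The kernel is positive away from \<open>x\<close> and points
  are null, so \<open>\<rho>\<close> would be zero almost everywhere.\<close>

lemma I_energy_pos:
  fixes \<rho> :: "real^'n \<Rightarrow> real"
  assumes "\<rho> \<in> HLS_admissible q"
  shows "I_energy l \<rho> \<noteq> 0"
proof
  assume z: "I_energy l \<rho> = 0"
  have adm: "\<rho> \<in> nonneg_L1_Lq q" "\<not> (AE x in lebesgue. \<rho> x = 0)"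
    using assms by (auto simp: HLS_admissible_def)
  note [measurable] = nonneg_L1_LqD(1)[OF adm(1)] and nn = nonneg_L1_LqD(2)[OF adm(1)]
  let ?\<Phi> = "\<lambda>x. \<integral>\<^sup>+y. ennreal (norm (x - y) powr l * \<rho> y) \<partial>lebesgue"
  have [measurable]: "?\<Phi> \<in> borel_measurable lebesgue"
    by (rule measurable_potential) (use nn in auto)
  have "AE x in lebesgue. ennreal (\<rho> x) * ?\<Phi> x = 0"
    using z by (subst (asm) I_energy_iterated) (use nn in \<open>auto simp: nn_integral_0_iff_AE\<close>)
  then have AE: "AE x in lebesgue. ?\<Phi> x \<noteq> 0 \<longrightarrow> \<rho> x = 0"
    by eventually_elim (use nn in \<open>auto simp: ennreal_eq_0_iff intro: antisym\<close>)
  have "\<exists>x. \<rho> x \<noteq> 0 \<and> ?\<Phi> x = 0"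
  proof (rule ccontr)
    assume "\<not> ?thesis"
    with AE have "AE x in lebesgue. \<rho> x = 0" by auto
    with adm(2) show False by simp
  qed
  then obtain x where x: "\<rho> x \<noteq> 0" "?\<Phi> x = 0" by blast
  have "(\<lambda>y. norm (x - y) powr l) \<in> borel_measurable lebesgue"
    using measurable_lebesgue_norm_powr[of x l] by (simp add: norm_minus_commute)
  with x(2) have "AE y in lebesgue. norm (x - y) powr l * \<rho> y \<le> 0"
    by (simp add: nn_integral_0_iff_AE ennreal_eq_0_iff)
  moreover have "AE y in lebesgue. y \<noteq> x"
    by (intro AE_completion AE_lborel_singleton)
  ultimately have "AE y in lebesgue. \<rho> y = 0"
    by eventually_elim (use nn in \<open>auto simp: mult_le_0_iff intro: antisym\<close>)
  with adm(2) show False by simp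
qed

text \<open>\<open>i / M\<close> is the mean of the potential with respect to the weight
  \<open>\<rho>\<close>, so the potential cannot exceed it everywhere. The slack \<open>+ 1\<close>
  makes the contradiction strict from weak inequalities alone.\<close>

lemma exists_small_potential:
  fixes \<rho> :: "real^'n \<Rightarrow> real"
  assumes "\<rho> \<in> densities q M" "0 < M" "I_energy l \<rho> = ennreal i" "0 \<le> i"
  shows "\<exists>a. (\<integral>\<^sup>+y. ennreal (norm (a - y) powr l * \<rho> y) \<partial>lebesgue) \<le> ennreal ((i + 1) / M)"
proof (rule ccontr)
  assume "\<not> ?thesis"
  then have less: "ennreal ((i + 1) / M) \<le> (\<integral>\<^sup>+y. ennreal (norm (a - y) powr l * \<rho> y) \<partial>lebesgue)" for a
    by (metis linear)
  have \<rho>: "\<rho> \<in> nonneg_L1_Lq q" "(LINT x|lebesgue. \<rho> x) = M"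
    using assms(1) by (auto simp: densities_def)
  note [measurable] = nonneg_L1_LqD(1)[OF \<rho>(1)] and nn = nonneg_L1_LqD(2)[OF \<rho>(1)]
  have "ennreal (i + 1) = ennreal M * ennreal ((i + 1) / M)"
    using assms by (simp flip: ennreal_mult)
  also have "\<dots> = (\<integral>\<^sup>+x. ennreal (\<rho> x) * ennreal ((i + 1) / M) \<partial>lebesgue)"
    using nonneg_L1_LqD(3)[OF \<rho>(1)] \<rho>(2) by (simp add: nn_integral_multc)
  also have "\<dots> \<le> I_energy l \<rho>"
    by (subst I_energy_iterated) (auto simp: nn intro!: nn_integral_mono mult_left_mono less)
  finally show False using assms by simp
qed

section \<open>Boundedness from below above the critical exponent\<close>

text \<open>Weighted AM-GM with weights \<open>q\<close> and \<open>1 - q\<close> for the numbers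
  \<open>v * u\<close> and \<open>v powr (- (q / (1 - q)))\<close>; the second is chosen so that
  \<open>v\<close> cancels from the geometric mean.\<close>

lemma powr_le_weighted:
  fixes q u v :: real
  assumes "0 < q" "q < 1" "0 \<le> u" "0 < v"
  shows "u powr q \<le> q * (v * u) + (1 - q) * v powr (- (q / (1 - q)))"
proof (cases "u = 0")
  case False
  then have "(v * u) powr q * (v powr (- (q / (1 - q)))) powr (1 - q)
      \<le> q * (v * u) + (1 - q) * v powr (- (q / (1 - q)))"
    by (intro Youngs_inequality_0) (use assms in auto)
  moreover have "- (q / (1 - q)) * (1 - q) = - q" using assms by (simp add: field_simps)
  then have "(v powr (- (q / (1 - q)))) powr (1 - q) = v powr (- q)"
    by (simp only: powr_powr)
  moreover have "(v * u) powr q * v powr (- q) = u powr q"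
    using assms by (simp add: powr_mult powr_minus field_simps)
  ultimately show ?thesis by simp
qed (use assms in simp)

text \<open>One term of the series suffices: that of the smallest dyadic ball containing
  \<open>x\<close>. Outside the ball of half its radius the weight is at most
  \<open>2 powr (- ((k - 1) * l * p))\<close>, and the factor \<open>2 powr (p * l)\<close> pays for
  the shift from \<open>k - 1\<close> to \<open>k\<close>.\<close>

lemma weight_le_dyadic:
  fixes x a :: "real^'n"
  assumes "0 < l" "0 < p"
  shows "ennreal ((1 + norm (x - a) powr l) powr (- p)) \<le>
    (\<Sum>k. ennreal (2 powr (p * l) * 2 powr (- (real k * l * p))) * indicator (ball a (2 ^ k)) x)"
proof -
  obtain n where n: "norm (x - a) < 2 ^ n"
    using real_arch_pow[of 2 "norm (x - a)"] by auto
  define k where "k = (LEAST k. norm (x - a) < 2 ^ k)"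
  have k: "norm (x - a) < 2 ^ k" unfolding k_def by (rule LeastI, rule n)
  have "(1 + norm (x - a) powr l) powr (- p) \<le> 2 powr (p * l) * 2 powr (- (real k * l * p))"
  proof (cases k)
    \<comment> \<open>Inside the unit ball there is no lower bound on the distance, but the weight
      is at most 1.\<close>
    case 0
    have "(1 + norm (x - a) powr l) powr (- p) \<le> 1 powr (- p)"
      using assms by (intro powr_mono2') auto
    also have "\<dots> \<le> 2 powr (p * l)" using assms by (simp add: ge_one_powr_ge_zero)
    finally show ?thesis using 0 by simp
  next
    case (Suc j)
    then have "\<not> norm (x - a) < 2 ^ j" using not_less_Least[of j "\<lambda>k. norm (x - a) < 2 ^ k"] unfolding k_def by auto
    then have "(2 ^ j) powr l \<le> norm (x - a) powr l"
      using assms by (intro powr_mono2) auto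
    then have "(1 + norm (x - a) powr l) powr (- p) \<le> ((2 ^ j) powr l) powr (- p)"
      using assms by (intro powr_mono2') (auto simp: add_increasing)
    also have "\<dots> = 2 powr (p * l) * 2 powr (- (real k * l * p))"
      by (simp add: Suc powr_powr algebra_simps flip: powr_realpow powr_add)
    finally show ?thesis .
  qed
  then have "ennreal ((1 + norm (x - a) powr l) powr (- p)) \<le>
    ennreal (2 powr (p * l) * 2 powr (- (real k * l * p))) * indicator (ball a (2 ^ k)) x"
    using k by (simp add: dist_norm norm_minus_commute ennreal_leI)
  also have "\<dots> \<le> (\<Sum>k. ennreal (2 powr (p * l) * 2 powr (- (real k * l * p))) * indicator (ball a (2 ^ k)) x)"
    using sum_le_suminf[of "\<lambda>k. ennreal (2 powr (p * l) * 2 powr (- (real k * l * p))) * indicator (ball a (2 ^ k)) x" "{k}"]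
    by (simp del: sum_mult_indicator)
  finally show ?thesis .
qed

text \<open>Integrating the dyadic bound leaves a geometric series of ratio
  \<open>2 powr (N - l * p) < 1\<close>. The bound \<open>K\<close> must not depend on the centre
  \<open>a\<close>, because the centre will vary with the density.\<close>

lemma weight_integral_bound:
  assumes "0 < l" "0 < p" "real CARD('n) < l * p"
  shows "\<exists>K\<ge>0. \<forall>a::real^'n. (\<integral>\<^sup>+x. ennreal ((1 + norm (x - a) powr l) powr (- p)) \<partial>lebesgue) \<le> ennreal K"
proof -
  define c where "c = 2 powr (p * l) * unit_ball_vol CARD('n)"
  define r where "r = 2 powr (real CARD('n) - l * p)"
  have c: "0 \<le> c" by (simp add: c_def)
  have r0: "0 < r" by (simp add: r_def)
  have r: "0 \<le> r" "r < 1"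
    using assms powr_less_mono[of "real CARD('n) - l * p" 0 2] by (auto simp: r_def)
  have "(\<integral>\<^sup>+x. ennreal ((1 + norm (x - a) powr l) powr (- p)) \<partial>lebesgue) \<le> ennreal (c / (1 - r))" for a :: "real^'n"
  proof -
    have "(\<integral>\<^sup>+x. ennreal ((1 + norm (x - a) powr l) powr (- p)) \<partial>lebesgue) \<le>
      (\<integral>\<^sup>+x. (\<Sum>k. ennreal (2 powr (p * l) * 2 powr (- (real k * l * p))) * indicator (ball a (2 ^ k)) x) \<partial>lebesgue)"
      by (intro nn_integral_mono weight_le_dyadic assms)
    also have "\<dots> = (\<Sum>k. \<integral>\<^sup>+x. ennreal (2 powr (p * l) * 2 powr (- (real k * l * p))) * indicator (ball a (2 ^ k)) x \<partial>lebesgue)"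
    proof (rule nn_integral_suminf)
      fix k
      have "ball a (2 ^ k) \<in> sets lebesgue" by simp
      then show "(\<lambda>x. ennreal (2 powr (p * l) * 2 powr (- (real k * l * p))) * indicator (ball a (2 ^ k)) x) \<in> borel_measurable lebesgue"
        by (intro borel_measurable_times_ennreal borel_measurable_const borel_measurable_indicator)
    qed
    also have "\<dots> = (\<Sum>k. ennreal (c * r ^ k))"
    proof (intro suminf_cong)
      fix k :: nat
      have "r ^ k = r powr real k"
        using r0 by (simp add: powr_realpow)
      also have "\<dots> = 2 powr (real k * (real CARD('n) - l * p))"
        unfolding r_def powr_powr by (simp only: mult.commute)
      also have "\<dots> = 2 powr (- (real k * l * p)) * 2 powr (real k * real CARD('n))"
        by (simp add: algebra_simps flip: powr_add)
      also have "2 powr (real k * real CARD('n)) = ((2::real) ^ k) ^ CARD('n)"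
        using powr_realpow[of 2 "k * CARD('n)"] by (simp add: power_mult)
      finally have e: "r ^ k = 2 powr (- (real k * l * p)) * (2 ^ k) ^ CARD('n)" .
      have "(\<integral>\<^sup>+x. ennreal (2 powr (p * l) * 2 powr (- (real k * l * p))) * indicator (ball a (2 ^ k)) x \<partial>lebesgue)
        = ennreal (2 powr (p * l) * 2 powr (- (real k * l * p))) * ennreal (unit_ball_vol CARD('n) * (2 ^ k) ^ CARD('n))"
        by (subst nn_integral_cmult_indicator) (simp_all only: lmeasurable_ball fmeasurableD emeasure_lebesgue_ball zero_le_power zero_le_numeral)
      also have "\<dots> = ennreal (c * r ^ k)"
        unfolding e c_def by (simp add: algebra_simps flip: ennreal_mult)
      finally show "(\<integral>\<^sup>+x. ennreal (2 powr (p * l) * 2 powr (- (real k * l * p))) * indicator (ball a (2 ^ k)) x \<partial>lebesgue)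
        = ennreal (c * r ^ k)" .
    qed
    also have "\<dots> = ennreal (c / (1 - r))"
      using sums_mult[OF geometric_sums[of r], of c] r c by (intro suminf_ennreal_eq) auto
    finally show ?thesis .
  qed
  then show ?thesis using r c by (intro exI[of _ "c / (1 - r)"]) auto
qed

lemma free_energy_eq:
  assumes "I_energy l \<rho> = ennreal i" "0 \<le> i"
  shows "free_energy l q \<rho> = ereal (i / (2 * l) - (LINT x|lebesgue. \<rho> x powr q) / (1 - q))"
  using assms by (simp add: free_energy_def)

lemma free_energy_infinite:
  assumes "I_energy l \<rho> = \<infinity>" "0 < l"
  shows "free_energy l q \<rho> = \<infinity>"
  using assms by (simp add: free_energy_def)

lemma free_energy_bounded_below:
  assumes l: "0 < l" and q: "0 < q" "q < 1" and M: "0 < M"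
    and qN: "real CARD('n) / (real CARD('n) + l) < q"
  shows "bounded_from_below_on (free_energy l q) (densities q M :: (real^'n \<Rightarrow> real) set)"
proof -
  define p where "p = q / (1 - q)"
  have p: "0 < p" using q by (simp add: p_def)
  have "real CARD('n) < q * (real CARD('n) + l)"
    using qN l by (simp add: field_simps)
  \<comment> \<open>For \<open>p = q / (1 - q)\<close> the condition q > N/(N + l) is exactly N <
    \<open>l * p\<close>, the integrability condition for the weight.\<close>
  then have lp: "real CARD('n) < l * p" using q by (simp add: p_def field_simps)
  from weight_integral_bound[OF l p lp]
  obtain K where K: "0 \<le> K" "\<And>a::real^'n. (\<integral>\<^sup>+x. ennreal ((1 + norm (x - a) powr l) powr (- p)) \<partial>lebesgue) \<le> ennreal K"
    by blast
  \<comment> \<open>Chosen so that the coefficient \<open>q * \<epsilon> / (M * (1 - q))\<close> of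
    \<open>i\<close> in the final estimate equals \<open>1 / (2 * l)\<close>, cancelling the
    interaction term.\<close>
  define \<epsilon> where "\<epsilon> = M * (1 - q) / (2 * l * q)"
  have \<epsilon>: "0 < \<epsilon>" using l q M by (simp add: \<epsilon>_def)
  \<comment> \<open>Everything in the final estimate that does not multiply
    \<open>i\<close>.\<close>
  define C where "C = q * \<epsilon> * (M + 1 / M) / (1 - q) + \<epsilon> powr (- p) * K"
  have "ereal (- C) \<le> free_energy l q \<rho>" if d: "\<rho> \<in> densities q M" for \<rho> :: "real^'n \<Rightarrow> real"
  proof (cases "I_energy l \<rho>")
    case top
    then show ?thesis using free_energy_infinite[of l \<rho> q] l by simp
  next
    case (real i)
    have \<rho>: "\<rho> \<in> nonneg_L1_Lq q" "(LINT x|lebesgue. \<rho> x) = M"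
      using d by (auto simp: densities_def)
    note [measurable] = nonneg_L1_LqD(1)[OF \<rho>(1)] and nn = nonneg_L1_LqD(2)[OF \<rho>(1)]
    obtain a where a: "(\<integral>\<^sup>+y. ennreal (norm (a - y) powr l * \<rho> y) \<partial>lebesgue) \<le> ennreal ((i + 1) / M)"
      using exists_small_potential[OF d M real(2) real(1)] by blast
    define w where "w x = 1 + norm (x - a) powr l" for x
    have w[measurable]: "w \<in> borel_measurable lebesgue" unfolding w_def[abs_def] by measurable
    have w1: "1 \<le> w x" for x by (simp add: w_def)
    have "ennreal (LINT x|lebesgue. \<rho> x powr q) = (\<integral>\<^sup>+x. ennreal (\<rho> x powr q) \<partial>lebesgue)"
      using nonneg_L1_LqD(4)[OF \<rho>(1)] by simp
    \<comment> \<open>Young's inequality with \<open>v = \<epsilon> * w x\<close>. Expanding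
      \<open>w x * \<rho> x\<close> separates the mass from the potential at \<open>a\<close>, which
      are the two integrals under control.\<close>
    also have "\<dots> \<le> (\<integral>\<^sup>+x. ennreal (q * \<epsilon>) * (ennreal (\<rho> x) + ennreal (norm (a - x) powr l * \<rho> x)) +
        ennreal ((1 - q) * \<epsilon> powr (- p)) * ennreal (w x powr (- p)) \<partial>lebesgue)"
    proof (intro nn_integral_mono)
      fix x
      have "0 < \<epsilon> * w x" using \<epsilon> w1[of x] by simp
      from powr_le_weighted[OF q nn[of x] this]
      have "\<rho> x powr q \<le> q * (\<epsilon> * w x * \<rho> x) + (1 - q) * (\<epsilon> * w x) powr (- p)"
        by (simp add: p_def)
      also have "\<dots> = q * \<epsilon> * (\<rho> x + norm (a - x) powr l * \<rho> x) + (1 - q) * \<epsilon> powr (- p) * w x powr (- p)"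
        using \<epsilon> w1[of x] by (simp add: powr_mult) (simp add: w_def algebra_simps norm_minus_commute)
      finally show "ennreal (\<rho> x powr q) \<le> ennreal (q * \<epsilon>) * (ennreal (\<rho> x) + ennreal (norm (a - x) powr l * \<rho> x)) +
        ennreal ((1 - q) * \<epsilon> powr (- p)) * ennreal (w x powr (- p))"
        using \<epsilon> q nn[of x] by (simp add: ennreal_leI flip: ennreal_plus ennreal_mult)
    qed
    also have "\<dots> = ennreal (q * \<epsilon>) * ((\<integral>\<^sup>+x. ennreal (\<rho> x) \<partial>lebesgue) + (\<integral>\<^sup>+x. ennreal (norm (a - x) powr l * \<rho> x) \<partial>lebesgue)) +
        ennreal ((1 - q) * \<epsilon> powr (- p)) * (\<integral>\<^sup>+x. ennreal (w x powr (- p)) \<partial>lebesgue)"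
    proof -
      have [measurable]: "(\<lambda>x. norm (a - x) powr l) \<in> borel_measurable lebesgue"
        using measurable_lebesgue_norm_powr[of a l] by (simp add: norm_minus_commute)
      show ?thesis by (simp add: nn_integral_add nn_integral_cmult)
    qed
    also have "\<dots> \<le> ennreal (q * \<epsilon>) * (ennreal M + ennreal ((i + 1) / M)) + ennreal ((1 - q) * \<epsilon> powr (- p)) * ennreal K"
      using nonneg_L1_LqD(3)[OF \<rho>(1)] \<rho>(2) a K(2)[of a]
      by (intro add_mono mult_left_mono) (auto simp: w_def)
    also have "\<dots> = ennreal (q * \<epsilon> * (M + (i + 1) / M) + (1 - q) * \<epsilon> powr (- p) * K)"
      using q \<epsilon> M K(1) real by (simp flip: ennreal_plus ennreal_mult)
    finally have X: "(LINT x|lebesgue. \<rho> x powr q) \<le> q * \<epsilon> * (M + (i + 1) / M) + (1 - q) * \<epsilon> powr (- p) * K"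
      using q \<epsilon> M K(1) real by (subst (asm) ennreal_le_iff) auto
    have "(LINT x|lebesgue. \<rho> x powr q) / (1 - q) \<le> (q * \<epsilon> * (M + (i + 1) / M) + (1 - q) * \<epsilon> powr (- p) * K) / (1 - q)"
      using X q by (intro divide_right_mono) auto
    also have "\<dots> = q * \<epsilon> * i / (M * (1 - q)) + C"
    proof -
      have "M + (i + 1) / M = i / M + (M + 1 / M)" by (simp add: add_divide_distrib)
      then show ?thesis using q unfolding C_def by (simp add: add_divide_distrib distrib_left)
    qed
    also have "q * \<epsilon> * i / (M * (1 - q)) = i / (2 * l)"
      using q M l by (simp add: \<epsilon>_def field_simps)
    finally show ?thesis using free_energy_eq[of l \<rho> i q] real by simp
  qed
  then show ?thesis unfolding bounded_from_below_on_def by blast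
qed

section \<open>Dyadic profiles at and below the critical exponent\<close>

lemma measurable_lebesgue_indicator_ball [measurable]:
  "indicator (ball (a::real^'n) r) \<in> borel_measurable lebesgue"
  "indicat_real (ball (a::real^'n) r) \<in> borel_measurable lebesgue"
  by (intro borel_measurable_indicator; simp)+

lemma nn_integral_indicator_ball:
  assumes "0 \<le> r"
  shows "(\<integral>\<^sup>+x. c * indicator (ball (a::real^'n) r) x \<partial>lebesgue) = c * ennreal (unit_ball_vol CARD('n) * r ^ CARD('n))"
  using assms by (subst nn_integral_cmult_indicator) (simp_all only: lmeasurable_ball fmeasurableD emeasure_lebesgue_ball)

lemma nn_integral_dyadic_ball:
  "(\<integral>\<^sup>+x. ennreal (2 powr (- (real k * real CARD('n)))) * indicator (ball (a::real^'n) (2 ^ k)) x \<partial>lebesgue)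
    = ennreal (unit_ball_vol CARD('n))"
proof -
  have "2 powr (real k * real CARD('n)) = ((2::real) ^ k) ^ CARD('n)"
    using powr_realpow[of 2 "k * CARD('n)"] by (simp add: power_mult)
  then have "2 powr (- (real k * real CARD('n))) * (unit_ball_vol CARD('n) * (2 ^ k) ^ CARD('n)) = unit_ball_vol CARD('n)"
    by (simp add: powr_minus)
  then show ?thesis
    by (simp add: nn_integral_indicator_ball flip: ennreal_mult)
qed

text \<open>A step version of |x| to the power -(N + l), cut off near the origin and at radius
  \<open>2 ^ n\<close>. The heights are such that every layer has the same moment of order
  \<open>l\<close>.\<close>

definition dyadic_profile :: "real \<Rightarrow> nat \<Rightarrow> real ^ 'n \<Rightarrow> real" where
  "dyadic_profile l n x =
     (\<Sum>k<n. 2 powr (- (real k * (real CARD('n) + l))) * indicat_real (ball 0 (2 ^ k)) x)"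

lemma dyadic_profile_measurable [measurable]: "dyadic_profile l n \<in> borel_measurable lebesgue"
  unfolding dyadic_profile_def[abs_def] by measurable

lemma dyadic_profile_nonneg: "0 \<le> dyadic_profile l n x"
  unfolding dyadic_profile_def by (intro sum_nonneg) auto

lemma dyadic_profile_le:
  fixes x :: "real^'n"
  assumes "0 \<le> l"
  shows "dyadic_profile l n x \<le> real n"
proof -
  have "dyadic_profile l n x \<le> (\<Sum>k<n. 1)"
    unfolding dyadic_profile_def
  proof (intro sum_mono)
    fix k
    have "2 powr (- (real k * (real CARD('n) + l))) \<le> (2::real) powr 0"
      using assms by (intro powr_mono) auto
    then show "2 powr (- (real k * (real CARD('n) + l))) * indicat_real (ball 0 (2 ^ k)) x \<le> 1"
      by (auto simp: indicator_def)
  qed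
  then show ?thesis by simp
qed

lemma dyadic_profile_eq_0: "2 ^ n \<le> norm x \<Longrightarrow> dyadic_profile l n x = 0"
  unfolding dyadic_profile_def
proof (intro sum.neutral ballI)
  fix k assume "2 ^ n \<le> norm x" "k \<in> {..<n}"
  moreover from this have "(2::real) ^ k \<le> 2 ^ n"
    by (intro power_increasing) auto
  ultimately have "(2::real) ^ k \<le> norm x" by linarith
  then show "2 powr (- (real k * (real CARD('a) + l))) * indicat_real (ball 0 (2 ^ k)) x = 0"
    by simp
qed

text \<open>On the layer of index \<open>k\<close> the weight turns the height
  \<open>2 powr (- (k * (N + l)))\<close> into at most \<open>2 powr (- (k * N))\<close>, whose
  integral over the ball is the unit ball volume. The weight 1 gives the mass, and the power
  \<open>l\<close> of the norm gives the moment.\<close>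

lemma dyadic_profile_moment:
  fixes w :: "real^'n \<Rightarrow> real"
  assumes "\<And>k x. norm x < 2 ^ k \<Longrightarrow> w x \<le> 2 powr (real k * l)"
  shows "(\<integral>\<^sup>+x. ennreal (dyadic_profile l n x * w x) \<partial>lebesgue) \<le> ennreal (real n * unit_ball_vol CARD('n))"
proof -
  have "(\<integral>\<^sup>+x. ennreal (dyadic_profile l n x * w x) \<partial>lebesgue) \<le>
    (\<integral>\<^sup>+x. (\<Sum>k<n. ennreal (2 powr (- (real k * real CARD('n)))) * indicator (ball (0::real^'n) (2 ^ k)) x) \<partial>lebesgue)"
  proof (intro nn_integral_mono)
    fix x :: "real^'n"
    have "dyadic_profile l n x * w x \<le> (\<Sum>k<n. 2 powr (- (real k * real CARD('n))) * indicator (ball 0 (2 ^ k)) x)"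
      unfolding dyadic_profile_def sum_distrib_right
    proof (intro sum_mono)
      fix k
      show "2 powr (- (real k * (real CARD('n) + l))) * indicat_real (ball 0 (2 ^ k)) x * w x
        \<le> 2 powr (- (real k * real CARD('n))) * indicator (ball 0 (2 ^ k)) x"
      proof (cases "norm x < 2 ^ k")
        case True
        then have "2 powr (- (real k * (real CARD('n) + l))) * w x \<le> 2 powr (- (real k * (real CARD('n) + l))) * 2 powr (real k * l)"
          by (intro mult_left_mono assms) auto
        also have "\<dots> = 2 powr (- (real k * real CARD('n)))"
          by (simp add: algebra_simps flip: powr_add)
        finally show ?thesis using True by simp
      qed simp
    qed
    also have "ennreal \<dots> = (\<Sum>k<n. ennreal (2 powr (- (real k * real CARD('n)))) * indicator (ball 0 (2 ^ k)) x)"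
      by (simp add: ennreal_mult ennreal_indicator flip: sum_ennreal del: sum_mult_indicator)
    finally show "ennreal (dyadic_profile l n x * w x) \<le> (\<Sum>k<n. ennreal (2 powr (- (real k * real CARD('n)))) * indicator (ball 0 (2 ^ k)) x)"
      by (simp add: ennreal_leI del: sum_mult_indicator)
  qed
  also have "\<dots> = (\<Sum>k<n. \<integral>\<^sup>+x. ennreal (2 powr (- (real k * real CARD('n)))) * indicator (ball (0::real^'n) (2 ^ k)) x \<partial>lebesgue)"
    by (rule nn_integral_sum) measurable
  also have "\<dots> = ennreal (real n * unit_ball_vol CARD('n))"
    by (simp add: nn_integral_dyadic_ball ennreal_mult ennreal_of_nat_eq_real_of_nat)
  finally show ?thesis .
qed

text \<open>A telescoping sum: since N is at least 1, half of a term is at most its difference to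
  the next one.\<close>

lemma dyadic_sum_le:
  fixes N :: real
  assumes "1 \<le> N" "m \<le> n"
  shows "(\<Sum>k=m..<n. 2 powr (- (real k * N)) / 2) \<le> 2 powr (- (real m * N)) - 2 powr (- (real n * N))"
  using assms(2)
proof (induction n rule: dec_induct)
  case (step k)
  have "2 powr (- (real (Suc k) * N)) = 2 powr (- (real k * N)) * 2 powr (- N)"
    by (simp add: algebra_simps flip: powr_add)
  also have "\<dots> \<le> 2 powr (- (real k * N)) * 2 powr (- 1)"
    using assms by (intro mult_left_mono powr_mono) auto
  finally show ?case using step by (simp add: powr_minus)
qed simp

text \<open>Let \<open>m\<close> index the smallest ball containing \<open>x\<close>. That layer
  alone makes the right-hand side at least \<open>2 powr (- (m * (N + l) * q))\<close>, which by
  \<open>q * (N + l) \<le> N\<close> is at least \<open>2 powr (- (m * N))\<close>. This dominates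
  the geometric sum on the left, where only \<open>k \<ge> m\<close> contributes.\<close>

lemma dyadic_profile_powr_ge:
  fixes x :: "real^'n"
  assumes "0 < q" "q * (real CARD('n) + l) \<le> real CARD('n)"
  shows "(\<Sum>k<n. 2 powr (- (real k * real CARD('n))) / 2 * indicat_real (ball 0 (2 ^ k)) x) \<le> dyadic_profile l n x powr q"
proof (cases "\<exists>k<n. norm x < 2 ^ k")
  case True
  let ?N = "real CARD('n)"
  define m where "m = (LEAST k. norm x < 2 ^ k)"
  obtain j where j: "j < n" "norm x < 2 ^ j" using True by auto
  have m: "norm x < 2 ^ m" "m < n"
    using LeastI[of "\<lambda>k. norm x < 2 ^ k" j] Least_le[of "\<lambda>k. norm x < 2 ^ k" j] j by (auto simp: m_def)
  have ge: "m \<le> k" if "norm x < 2 ^ k" for k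
    unfolding m_def by (rule Least_le) (rule that)
  have N1: "1 \<le> ?N" by simp
  have "(\<Sum>k<n. 2 powr (- (real k * ?N)) / 2 * indicat_real (ball 0 (2 ^ k)) x) \<le>
      (\<Sum>k=m..<n. 2 powr (- (real k * ?N)) / 2)"
  proof -
    have "(\<Sum>k<n. 2 powr (- (real k * ?N)) / 2 * indicat_real (ball 0 (2 ^ k)) x) =
      (\<Sum>k=m..<n. 2 powr (- (real k * ?N)) / 2 * indicat_real (ball 0 (2 ^ k)) x)"
    proof (rule sum.mono_neutral_right)
      show "\<forall>k\<in>{..<n} - {m..<n}. 2 powr (- (real k * ?N)) / 2 * indicat_real (ball 0 (2 ^ k)) x = 0"
        using ge by (force simp: indicator_def)
    qed auto
    also have "\<dots> \<le> (\<Sum>k=m..<n. 2 powr (- (real k * ?N)) / 2)"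
      by (intro sum_mono) (auto simp: indicator_def)
    finally show ?thesis .
  qed
  also have "\<dots> \<le> 2 powr (- (real m * ?N)) - 2 powr (- (real n * ?N))"
    using m N1 by (intro dyadic_sum_le) auto
  also have "\<dots> \<le> 2 powr (- (real m * ?N))" by simp
  also have "\<dots> \<le> 2 powr (- (real m * (?N + l)) * q)"
  proof (intro powr_mono)
    have "real m * (q * (?N + l)) \<le> real m * ?N"
      using assms by (intro mult_left_mono) auto
    then show "- (real m * ?N) \<le> - (real m * (?N + l)) * q" by (simp add: algebra_simps)
  qed simp
  also have "\<dots> = (2 powr (- (real m * (?N + l)))) powr q" by (simp only: powr_powr)
  also have "\<dots> \<le> dyadic_profile l n x powr q"
  proof (intro powr_mono2)
    have "2 powr (- (real m * (?N + l))) = 2 powr (- (real m * (?N + l))) * indicat_real (ball 0 (2 ^ m)) x"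
      using m by simp
    also have "\<dots> \<le> dyadic_profile l n x"
      unfolding dyadic_profile_def using m by (intro member_le_sum) auto
    finally show "2 powr (- (real m * (?N + l))) \<le> dyadic_profile l n x" .
  qed (use assms in auto)
  finally show ?thesis .
next
  case False
  then have "(\<Sum>k<n. 2 powr (- (real k * real CARD('n))) / 2 * indicat_real (ball 0 (2 ^ k)) x) = 0"
    by (intro sum.neutral) (auto simp: indicator_def)
  then show ?thesis by simp
qed

text \<open>Each of the \<open>n\<close> layers of the pointwise bound integrates to half the unit
  ball volume. The growth is linear in \<open>n\<close>, like that of the mass, and dividing the
  profile by \<open>n\<close> costs only \<open>n powr q\<close>.\<close>

lemma dyadic_profile_powr_integral:
  assumes "0 < q" "q * (real CARD('n) + l) \<le> real CARD('n)"
  shows "ennreal (real n * unit_ball_vol CARD('n) / 2) \<le> (\<integral>\<^sup>+x. ennreal (dyadic_profile l n (x::real^'n) powr q) \<partial>lebesgue)"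
proof -
  have e: "ennreal (2 powr (- (real k * real CARD('n))) / 2) = ennreal (1 / 2) * ennreal (2 powr (- (real k * real CARD('n))))" for k
    by (subst ennreal_mult[symmetric]) auto
  have "ennreal (real n * unit_ball_vol CARD('n) / 2) = (\<Sum>k<n. ennreal (1 / 2 * unit_ball_vol CARD('n)))"
    by (subst sum_ennreal) simp_all
  also have "\<dots> = (\<Sum>k<n. ennreal (1 / 2) * ennreal (unit_ball_vol CARD('n)))"
    by (intro sum.cong refl ennreal_mult) simp_all
  also have "\<dots> = (\<Sum>k<n. \<integral>\<^sup>+x. ennreal (1 / 2) * (ennreal (2 powr (- (real k * real CARD('n)))) * indicator (ball (0::real^'n) (2 ^ k)) x) \<partial>lebesgue)"
    by (intro sum.cong refl, subst nn_integral_cmult) (measurable, simp only: nn_integral_dyadic_ball)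
  also have "\<dots> = (\<integral>\<^sup>+x. (\<Sum>k<n. ennreal (1 / 2) * (ennreal (2 powr (- (real k * real CARD('n)))) * indicator (ball (0::real^'n) (2 ^ k)) x)) \<partial>lebesgue)"
    by (rule nn_integral_sum[symmetric]) measurable
  also have "\<dots> \<le> (\<integral>\<^sup>+x. ennreal (dyadic_profile l n (x::real^'n) powr q) \<partial>lebesgue)"
  proof (intro nn_integral_mono)
    fix x :: "real^'n"
    have h: "ennreal (1 / 2) * (ennreal (2 powr (- (real k * real CARD('n)))) * indicator (ball 0 (2 ^ k)) x) =
      ennreal (2 powr (- (real k * real CARD('n))) / 2 * indicat_real (ball 0 (2 ^ k)) x)" for k
      by (simp only: ennreal_mult'' indicator_pos_le e ennreal_indicator mult.assoc)
    have "(\<Sum>k<n. ennreal (1 / 2) * (ennreal (2 powr (- (real k * real CARD('n)))) * indicator (ball 0 (2 ^ k)) x)) =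
      ennreal (\<Sum>k<n. 2 powr (- (real k * real CARD('n))) / 2 * indicat_real (ball 0 (2 ^ k)) x)"
      unfolding h by (rule sum_ennreal) simp
    also have "\<dots> \<le> ennreal (dyadic_profile l n x powr q)"
      by (intro ennreal_leI dyadic_profile_powr_ge assms)
    finally show "(\<Sum>k<n. ennreal (1 / 2) * (ennreal (2 powr (- (real k * real CARD('n)))) * indicator (ball 0 (2 ^ k)) x)) \<le> ennreal (dyadic_profile l n x powr q)" .
  qed
  finally show ?thesis .
qed

section \<open>Test densities of given mass and bounded energy\<close>

lemma Lp_fun_bounded_support:
  fixes \<rho> :: "real^'n \<Rightarrow> real"
  assumes [measurable]: "\<rho> \<in> borel_measurable lebesgue" and \<rho>: "\<And>x. 0 \<le> \<rho> x" "\<And>x. \<rho> x \<le> B"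
    "\<And>x. R \<le> norm x \<Longrightarrow> \<rho> x = 0" and R: "0 \<le> R" and p: "0 < p"
  shows "\<rho> \<in> Lp_fun p"
proof -
  have "(\<integral>\<^sup>+x. ennreal (\<bar>\<rho> x\<bar> powr p) \<partial>lebesgue) \<le> (\<integral>\<^sup>+x. ennreal (B powr p) * indicator (ball (0::real^'n) R) x \<partial>lebesgue)"
  proof (intro nn_integral_mono)
    fix x
    show "ennreal (\<bar>\<rho> x\<bar> powr p) \<le> ennreal (B powr p) * indicator (ball 0 R) x"
      using \<rho>[of x] p by (cases "norm x < R") (auto intro!: ennreal_leI powr_mono2)
  qed
  also have "\<dots> < \<infinity>"
    using R by (simp add: nn_integral_indicator_ball flip: ennreal_mult)
  finally show ?thesis by (simp add: Lp_fun_def)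
qed

text \<open>Bounding the distance by twice the larger norm treats \<open>l < 1\<close> and
  \<open>l \<ge> 1\<close> alike.\<close>

lemma norm_diff_powr_le:
  assumes "0 < l"
  shows "norm (x - y) powr l \<le> 2 powr l * (norm x powr l + norm y powr l)"
proof -
  have "norm (x - y) powr l \<le> (2 * max (norm x) (norm y)) powr l"
    using norm_triangle_ineq4[of x y] assms by (intro powr_mono2) auto
  also have "\<dots> = 2 powr l * max (norm x) (norm y) powr l"
    by (simp add: powr_mult)
  also have "\<dots> \<le> 2 powr l * (norm x powr l + norm y powr l)"
    by (intro mult_left_mono) (auto simp: max_def)
  finally show ?thesis .
qed

text \<open>Splitting the kernel by \<open>norm_diff_powr_le\<close> gives two equal terms, each the
  product of mass and moment.\<close>

lemma I_energy_le_moment: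
  fixes \<rho> :: "real^'n \<Rightarrow> real"
  assumes \<rho>: "\<rho> \<in> densities q M" and l: "0 < l" and M: "0 < M" and D: "0 \<le> D"
    and mom: "(\<integral>\<^sup>+x. ennreal (\<rho> x * norm x powr l) \<partial>lebesgue) \<le> ennreal D"
  shows "I_energy l \<rho> \<le> ennreal (2 powr l * (2 * M * D))"
proof -
  have \<rho>': "\<rho> \<in> nonneg_L1_Lq q" "(LINT x|lebesgue. \<rho> x) = M"
    using \<rho> by (auto simp: densities_def)
  note [measurable] = nonneg_L1_LqD(1)[OF \<rho>'(1)] and nn = nonneg_L1_LqD(2)[OF \<rho>'(1)]
  have mass: "(\<integral>\<^sup>+x. ennreal (\<rho> x) \<partial>lebesgue) = ennreal M"
    using nonneg_L1_LqD(3)[OF \<rho>'(1)] \<rho>'(2) by simp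
  have [measurable]: "(\<lambda>x::real^'n. norm x powr l) \<in> borel_measurable lebesgue"
    using measurable_lebesgue_norm_powr[of 0 l] by simp
  have inner: "(\<integral>\<^sup>+y. ennreal (norm (x - y) powr l * \<rho> y) \<partial>lebesgue) \<le> ennreal (2 powr l * (norm x powr l * M + D))" for x
  proof -
    have "(\<integral>\<^sup>+y. ennreal (norm (x - y) powr l * \<rho> y) \<partial>lebesgue) \<le>
      (\<integral>\<^sup>+y. ennreal (2 powr l) * (ennreal (norm x powr l) * ennreal (\<rho> y) + ennreal (\<rho> y * norm y powr l)) \<partial>lebesgue)"
    proof (intro nn_integral_mono)
      fix y
      have "norm (x - y) powr l * \<rho> y \<le> 2 powr l * (norm x powr l + norm y powr l) * \<rho> y"
        by (intro mult_right_mono norm_diff_powr_le l nn)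
      also have "\<dots> = 2 powr l * (norm x powr l * \<rho> y + \<rho> y * norm y powr l)"
        by (simp add: algebra_simps)
      finally show "ennreal (norm (x - y) powr l * \<rho> y) \<le> ennreal (2 powr l) * (ennreal (norm x powr l) * ennreal (\<rho> y) + ennreal (\<rho> y * norm y powr l))"
        using nn[of y] by (simp add: ennreal_leI flip: ennreal_mult ennreal_plus)
    qed
    also have "\<dots> = ennreal (2 powr l) * (ennreal (norm x powr l) * ennreal M + (\<integral>\<^sup>+y. ennreal (\<rho> y * norm y powr l) \<partial>lebesgue))"
      by (simp add: nn_integral_cmult nn_integral_add mass)
    also have "\<dots> \<le> ennreal (2 powr l) * (ennreal (norm x powr l) * ennreal M + ennreal D)"
      by (intro mult_left_mono add_left_mono mom) auto
    also have "\<dots> = ennreal (2 powr l * (norm x powr l * M + D))"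
      using M D by (simp flip: ennreal_mult ennreal_plus)
    finally show ?thesis .
  qed
  have "I_energy l \<rho> \<le> (\<integral>\<^sup>+x. ennreal (\<rho> x) * ennreal (2 powr l * (norm x powr l * M + D)) \<partial>lebesgue)"
    by (subst I_energy_iterated) (auto simp: nn intro!: nn_integral_mono mult_left_mono inner)
  also have "\<dots> = (\<integral>\<^sup>+x. ennreal (2 powr l * M) * ennreal (\<rho> x * norm x powr l) + ennreal (2 powr l * D) * ennreal (\<rho> x) \<partial>lebesgue)"
    using nn M D by (intro nn_integral_cong) (simp add: algebra_simps flip: ennreal_mult ennreal_plus)
  also have "\<dots> = ennreal (2 powr l * M) * (\<integral>\<^sup>+x. ennreal (\<rho> x * norm x powr l) \<partial>lebesgue) + ennreal (2 powr l * D) * ennreal M"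
    by (simp add: nn_integral_cmult nn_integral_add mass)
  also have "\<dots> \<le> ennreal (2 powr l * M) * ennreal D + ennreal (2 powr l * D) * ennreal M"
    by (intro add_right_mono mult_left_mono mom) auto
  also have "\<dots> = ennreal (2 powr l * (2 * M * D))"
    using M D by (simp add: algebra_simps flip: ennreal_mult ennreal_plus)
  finally show ?thesis .
qed

text \<open>The energy bound is uniform in \<open>n\<close> and holds for all \<open>q\<close> in
  (0,1), so it also provides a competitor of finite energy. Below the threshold the same densities
  have a large integral of \<open>\<rho> powr q\<close>.\<close>

lemma test_density:
  fixes n :: nat
  assumes l: "0 < l" and q: "0 < q" "q < 1" and M: "0 < M" and n: "0 < n"
  shows "\<exists>\<rho>\<in>(densities q M :: (real^'n \<Rightarrow> real) set).
    I_energy l \<rho> \<le> ennreal (2 powr l * (4 * M * M)) \<and>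
    (q * (real CARD('n) + l) \<le> real CARD('n) \<longrightarrow>
       (M / (real n * unit_ball_vol CARD('n))) powr q * (real n * unit_ball_vol CARD('n) / 2) \<le> (LINT x|lebesgue. \<rho> x powr q))"
proof -
  define \<omega> where "\<omega> = unit_ball_vol (real CARD('n))"
  have \<omega>: "0 < \<omega>" by (simp add: \<omega>_def)
  \<comment> \<open>Normalises the moment bound of the profile to \<open>M\<close>, for the mass as
    well as for the moment of order \<open>l\<close>.\<close>
  define \<kappa> where "\<kappa> = M / (real n * \<omega>)"
  have \<kappa>: "0 < \<kappa>" "\<kappa> * (real n * \<omega>) = M" using M n \<omega> by (auto simp: \<kappa>_def)
  let ?g = "dyadic_profile l n :: real^'n \<Rightarrow> real"
  have mom: "(\<integral>\<^sup>+x. ennreal (\<kappa> * ?g x * w x) \<partial>lebesgue) \<le> ennreal M"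
    if [measurable]: "w \<in> borel_measurable lebesgue" and w: "\<And>k x. norm x < 2 ^ k \<Longrightarrow> w x \<le> 2 powr (real k * l)" for w
  proof -
    have "(\<integral>\<^sup>+x. ennreal (\<kappa> * ?g x * w x) \<partial>lebesgue) = ennreal \<kappa> * (\<integral>\<^sup>+x. ennreal (?g x * w x) \<partial>lebesgue)"
      using \<kappa>(1) by (subst nn_integral_cmult[symmetric]) (auto simp: mult.assoc ennreal_mult')
    also have "\<dots> \<le> ennreal \<kappa> * ennreal (real n * unit_ball_vol CARD('n))"
      by (intro mult_left_mono dyadic_profile_moment w) auto
    also have "\<dots> = ennreal M"
      using \<kappa> \<omega> by (simp flip: ennreal_mult \<omega>_def)
    finally show ?thesis .
  qed
  have "(\<integral>\<^sup>+x. ennreal (\<kappa> * ?g x) \<partial>lebesgue) \<le> ennreal M"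
    using mom[of "\<lambda>_. 1"] l by (simp add: ge_one_powr_ge_zero)
  then obtain m where m: "0 \<le> m" "m \<le> M" "(\<integral>\<^sup>+x. ennreal (\<kappa> * ?g x) \<partial>lebesgue) = ennreal m"
    using M by (cases "\<integral>\<^sup>+x. ennreal (\<kappa> * ?g x) \<partial>lebesgue") (auto simp: top_unique)
  \<comment> \<open>The scaled profile has mass \<open>m \<le> M\<close>; height \<open>c\<close> on
    the unit ball supplies the missing \<open>M - m\<close>.\<close>
  define c where "c = (M - m) / \<omega>"
  have c: "0 \<le> c" "c * \<omega> = M - m" using m \<omega> by (auto simp: c_def)
  define \<rho> where "\<rho> x = \<kappa> * ?g x + c * indicat_real (ball 0 1) x" for x
  have meas[measurable]: "\<rho> \<in> borel_measurable lebesgue"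
    unfolding \<rho>_def[abs_def] by measurable
  have g: "0 \<le> ?g x" "?g x \<le> real n" for x
    using dyadic_profile_nonneg dyadic_profile_le[of l n x] l by auto
  have nn: "0 \<le> \<rho> x" for x using \<kappa> c g by (simp add: \<rho>_def)
  have le: "\<rho> x \<le> \<kappa> * real n + c" for x
    unfolding \<rho>_def using \<kappa> c g by (intro add_mono mult_left_mono mult_left_le) auto
  have supp: "\<rho> x = 0" if "2 ^ n \<le> norm x" for x
  proof -
    have "1 \<le> norm x" using that one_le_power[of "2::real" n] by linarith
    then show ?thesis using dyadic_profile_eq_0[OF that] by (simp add: \<rho>_def)
  qed
  have Lp: "\<rho> \<in> Lp_fun p" if "0 < p" for p
    by (rule Lp_fun_bounded_support[where B = "\<kappa> * real n + c" and R = "2 ^ n"])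
      (use meas nn le supp that in auto)
  have \<rho>: "\<rho> \<in> nonneg_L1_Lq q"
    using Lp q nn by (auto simp: nonneg_L1_Lq_def)
  have "ennreal (LINT x|lebesgue. \<rho> x) = (\<integral>\<^sup>+x. ennreal (\<rho> x) \<partial>lebesgue)"
    by (rule nonneg_L1_LqD(3)[OF \<rho>, symmetric])
  also have "\<dots> = (\<integral>\<^sup>+x. ennreal (\<kappa> * ?g x) + ennreal c * indicator (ball 0 1) x \<partial>lebesgue)"
    unfolding \<rho>_def using \<kappa> c g by (intro nn_integral_cong) (simp add: ennreal_mult ennreal_indicator)
  also have "\<dots> = ennreal m + ennreal c * ennreal \<omega>"
    by (subst nn_integral_add) (measurable, simp add: m nn_integral_indicator_ball \<omega>_def)
  also have "\<dots> = ennreal M"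
    using m c \<omega> by (simp flip: ennreal_mult ennreal_plus)
  finally have "(LINT x|lebesgue. \<rho> x) = M"
    using M nn by (subst (asm) ennreal_inj) (auto intro: integral_nonneg)
  with \<rho> have d: "\<rho> \<in> densities q M" by (simp add: densities_def)
  have [measurable]: "(\<lambda>x::real^'n. norm x powr l) \<in> borel_measurable lebesgue"
    using measurable_lebesgue_norm_powr[of 0 l] by simp
  have "(\<integral>\<^sup>+x. ennreal (\<rho> x * norm x powr l) \<partial>lebesgue) \<le>
      (\<integral>\<^sup>+x. ennreal (\<kappa> * ?g x * norm x powr l) + ennreal c * indicator (ball 0 1) x \<partial>lebesgue)"
  proof (intro nn_integral_mono)
    fix x :: "real^'n"
    \<comment> \<open>On the unit ball the moment is at most the mass, so the added part contributes
      at most \<open>M\<close> to the moment.\<close>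
    have "norm x powr l * indicat_real (ball 0 1) x \<le> indicat_real (ball 0 1) x"
      using l powr_mono2[of l "norm x" 1] by (auto simp: indicator_def)
    from mult_left_mono[OF this c(1)]
    have "\<rho> x * norm x powr l \<le> \<kappa> * ?g x * norm x powr l + c * indicat_real (ball 0 1) x"
      by (simp add: \<rho>_def algebra_simps)
    then show "ennreal (\<rho> x * norm x powr l) \<le> ennreal (\<kappa> * ?g x * norm x powr l) + ennreal c * indicator (ball 0 1) x"
      using c \<kappa> g[of x] by (simp add: ennreal_leI flip: ennreal_indicator ennreal_mult ennreal_plus)
  qed
  also have "\<dots> = (\<integral>\<^sup>+x. ennreal (\<kappa> * ?g x * norm x powr l) \<partial>lebesgue) + ennreal c * ennreal \<omega>"
    by (subst nn_integral_add) (measurable, simp add: nn_integral_indicator_ball \<omega>_def)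
  also have "\<dots> \<le> ennreal M + ennreal M"
  proof (intro add_mono mom)
    show "norm x powr l \<le> 2 powr (real k * l)" if "norm x < 2 ^ k" for k and x :: "real^'n"
    proof -
      have "norm x powr l \<le> (2 ^ k) powr l" using that l by (intro powr_mono2) auto
      then show ?thesis by (simp add: powr_powr flip: powr_realpow)
    qed
    show "ennreal c * ennreal \<omega> \<le> ennreal M"
      using c m \<omega> by (simp add: ennreal_leI flip: ennreal_mult)
  qed measurable
  also have "\<dots> = ennreal (2 * M)" using M by (simp flip: ennreal_plus)
  finally have "I_energy l \<rho> \<le> ennreal (2 powr l * (2 * M * (2 * M)))"
    using d l M by (intro I_energy_le_moment) auto
  then have I: "I_energy l \<rho> \<le> ennreal (2 powr l * (4 * M * M))" by (simp add: algebra_simps)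
  have "\<kappa> powr q * (real n * \<omega> / 2) \<le> (LINT x|lebesgue. \<rho> x powr q)" if "q * (real CARD('n) + l) \<le> real CARD('n)"
  proof -
    have "ennreal (\<kappa> powr q * (real n * \<omega> / 2)) = ennreal (\<kappa> powr q) * ennreal (real n * unit_ball_vol CARD('n) / 2)"
      using \<omega> by (simp add: \<omega>_def flip: ennreal_mult)
    also have "\<dots> \<le> ennreal (\<kappa> powr q) * (\<integral>\<^sup>+x. ennreal (?g x powr q) \<partial>lebesgue)"
      by (intro mult_left_mono dyadic_profile_powr_integral q that) auto
    also have "\<dots> = (\<integral>\<^sup>+x. ennreal ((\<kappa> * ?g x) powr q) \<partial>lebesgue)"
      using \<kappa> g by (subst nn_integral_cmult[symmetric]) (auto simp: powr_mult ennreal_mult)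
    also have "\<dots> \<le> (\<integral>\<^sup>+x. ennreal (\<rho> x powr q) \<partial>lebesgue)"
      using \<kappa> c g q by (intro nn_integral_mono ennreal_leI powr_mono2) (auto simp: \<rho>_def)
    finally show ?thesis
      unfolding nonneg_L1_LqD(4)[OF \<rho>] by (subst (asm) ennreal_le_iff) auto
  qed
  with d I show ?thesis unfolding \<kappa>_def \<omega>_def by blast
qed

text \<open>After normalisation the lower bound is \<open>A * n powr (1 - q)\<close>, which is
  unbounded in \<open>n\<close> since \<open>q < 1\<close>.\<close>

lemma test_density_large:
  assumes l: "0 < l" and q: "0 < q" "q < 1" and M: "0 < M"
    and qN: "q * (real CARD('n) + l) \<le> real CARD('n)"
  shows "\<exists>\<rho>\<in>(densities q M :: (real^'n \<Rightarrow> real) set).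
    I_energy l \<rho> \<le> ennreal (2 powr l * (4 * M * M)) \<and> R < (LINT x|lebesgue. \<rho> x powr q)"
proof -
  define \<omega> where "\<omega> = unit_ball_vol (real CARD('n))"
  have \<omega>: "0 < \<omega>" by (simp add: \<omega>_def)
  define A where "A = M powr q * \<omega> powr (1 - q) / 2"
  have A: "0 < A" using M \<omega> by (simp add: A_def)
  \<comment> \<open>\<open>A * B = \<bar>R\<bar> + A\<close> exceeds \<open>R\<close>, so it is
    enough that \<open>n powr (1 - q) > B\<close>.\<close>
  define B where "B = \<bar>R\<bar> / A + 1"
  have B: "0 < B" using A by (simp add: B_def add_nonneg_pos)
  obtain n :: nat where n: "B powr (1 / (1 - q)) < real n" using reals_Archimedean2 by blast
  then have n0: "0 < n" using B by (auto intro: Nat.gr0I)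
  have "B = (B powr (1 / (1 - q))) powr (1 - q)" using B q by (simp add: powr_powr)
  also have "\<dots> < real n powr (1 - q)" using n q by (intro powr_less_mono2) auto
  finally have "R < A * real n powr (1 - q)"
    using A by (simp add: B_def field_simps)
  also have "A * real n powr (1 - q) = (M / (real n * \<omega>)) powr q * (real n * \<omega> / 2)"
    using M n0 \<omega> by (simp add: A_def powr_divide powr_mult powr_diff mult_ac)
  finally show ?thesis
    using test_density[where 'n = 'n, OF l q M n0] qN unfolding \<omega>_def by fastforce
qed

lemma free_energy_unbounded_below:
  assumes l: "0 < l" and q: "0 < q" "q < 1" and M: "0 < M"
    and qN: "q * (real CARD('n) + l) \<le> real CARD('n)"
  shows "\<not> bounded_from_below_on (free_energy l q) (densities q M :: (real^'n \<Rightarrow> real) set)"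
proof
  assume "bounded_from_below_on (free_energy l q) (densities q M :: (real^'n \<Rightarrow> real) set)"
  then obtain c where c: "\<And>\<rho>::real^'n \<Rightarrow> real. \<rho> \<in> densities q M \<Longrightarrow> ereal c \<le> free_energy l q \<rho>"
    by (auto simp: bounded_from_below_on_def)
  define B where "B = 2 powr l * (4 * M * M)"
  \<comment> \<open>The interaction term stays at most \<open>B / (2 * l)\<close>; the threshold for
    the integral of \<open>\<rho> powr q\<close> is what pushes the free energy below
    \<open>c\<close>.\<close>
  obtain \<rho> :: "real^'n \<Rightarrow> real" where \<rho>: "\<rho> \<in> densities q M" "I_energy l \<rho> \<le> ennreal B"
      "(1 - q) * (B / (2 * l) - c) < (LINT x|lebesgue. \<rho> x powr q)"
    using test_density_large[OF l q M qN] unfolding B_def by blast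
  obtain i where i: "I_energy l \<rho> = ennreal i" "0 \<le> i" "i \<le> B"
    using \<rho>(2) M by (cases "I_energy l \<rho>") (auto simp: B_def top_unique)
  have "c \<le> i / (2 * l) - (LINT x|lebesgue. \<rho> x powr q) / (1 - q)"
    using c[OF \<rho>(1)] free_energy_eq[OF i(1,2)] by simp
  moreover have "i / (2 * l) \<le> B / (2 * l)" using i l by (intro divide_right_mono) auto
  moreover have "B / (2 * l) - c < (LINT x|lebesgue. \<rho> x powr q) / (1 - q)"
    using \<rho>(3) q by (simp add: pos_less_divide_eq mult.commute)
  ultimately show False by linarith
qed

section \<open>The quotient at fixed mass and its optimisers\<close>

lemma Lq_integral_pos:
  assumes "\<rho> \<in> HLS_admissible q"
  shows "0 < (LINT x|lebesgue. \<rho> x powr q)"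
proof -
  have \<rho>: "\<rho> \<in> nonneg_L1_Lq q" and nz: "\<not> (AE x in lebesgue. \<rho> x = 0)"
    using assms by (auto simp: HLS_admissible_def)
  note [measurable] = nonneg_L1_LqD(1)[OF \<rho>] and nn = nonneg_L1_LqD(2)[OF \<rho>]
  have "(LINT x|lebesgue. \<rho> x powr q) \<noteq> 0"
  proof
    assume "(LINT x|lebesgue. \<rho> x powr q) = 0"
    then have "(\<integral>\<^sup>+x. ennreal (\<rho> x powr q) \<partial>lebesgue) = 0"
      using nonneg_L1_LqD(4)[OF \<rho>] by simp
    then have "AE x in lebesgue. \<rho> x = 0"
      by (simp add: nn_integral_0_iff_AE)
    with nz show False by simp
  qed
  moreover have "0 \<le> (LINT x|lebesgue. \<rho> x powr q)" by (intro Bochner_Integration.integral_nonneg) auto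
  ultimately show ?thesis by (metis less_le)
qed

lemma densities_admissible:
  assumes "\<rho> \<in> densities q M" "0 < M"
  shows "\<rho> \<in> HLS_admissible q"
proof -
  have "(LINT x|lebesgue. \<rho> x) = 0" if "AE x in lebesgue. \<rho> x = 0"
    using that by (rule integral_eq_zero_AE)
  then show ?thesis using assms by (auto simp: densities_def HLS_admissible_def)
qed

text \<open>Puts the power of the integral of \<open>\<rho> powr q\<close> into the form matching
  dilations: it is \<open>l\<close>, the order of the energy, over N(1 - q), the order of that
  integral.\<close>

lemma HLS_power_eq:
  assumes "0 < q" "q < 1"
  shows "(2 - HLS_exponent CARD('n::finite) l q) / q = l / (real CARD('n) * (1 - q))"
proof -
  have "2 - HLS_exponent CARD('n) l q = q * l / (real CARD('n) * (1 - q))"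
    using assms by (simp add: HLS_exponent_def diff_divide_eq_iff) (simp add: algebra_simps)
  then show ?thesis using assms by simp
qed

lemma HLS_quotient_eq:
  fixes \<rho> :: "real^'n \<Rightarrow> real"
  assumes \<rho>: "\<rho> \<in> densities q M" and M: "0 < M" and q: "0 < q" "q < 1"
    and i: "I_energy l \<rho> = ennreal i" "0 \<le> i"
  shows "HLS_quotient l q \<rho> = ennreal (i / (M powr HLS_exponent CARD('n) l q *
    (LINT x|lebesgue. \<rho> x powr q) powr (l / (real CARD('n) * (1 - q)))))"
proof -
  have "(LINT x|lebesgue. \<rho> x) = M" using \<rho> by (simp add: densities_def)
  moreover have "0 < (LINT x|lebesgue. \<rho> x powr q)"
    using Lq_integral_pos[OF densities_admissible[OF \<rho> M]] .
  ultimately show ?thesis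
    using M i by (simp add: HLS_quotient_def HLS_power_eq[OF q] divide_ennreal)
qed

text \<open>A test density of the same mass makes the infimum finite, which excludes infinite energy
  of the optimiser; positivity is \<open>I_energy_pos\<close>.\<close>

lemma attains_HLS_const_finite:
  fixes \<sigma> :: "real^'n \<Rightarrow> real"
  assumes \<sigma>: "attains_HLS_const l q \<sigma>" and M: "(LINT x|lebesgue. \<sigma> x) = M" "0 < M"
    and l: "0 < l" and q: "0 < q" "q < 1"
  shows "\<exists>j>0. I_energy l \<sigma> = ennreal j"
proof -
  have adm: "\<sigma> \<in> HLS_admissible q" and eq: "HLS_quotient l q \<sigma> = HLS_const TYPE('n) l q"
    using \<sigma> by (auto simp: attains_HLS_const_def)
  obtain \<rho> :: "real^'n \<Rightarrow> real" where \<rho>: "\<rho> \<in> densities q M" "I_energy l \<rho> \<le> ennreal (2 powr l * (4 * M * M))"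
    using test_density[OF l q M(2), of 1] by auto
  obtain i where i: "I_energy l \<rho> = ennreal i" "0 \<le> i"
    using \<rho>(2) by (cases "I_energy l \<rho>") (auto simp: top_unique)
  have "HLS_quotient l q \<sigma> \<le> HLS_quotient l q \<rho>"
    unfolding eq HLS_const_def by (rule INF_lower) (rule densities_admissible[OF \<rho>(1) M(2)])
  then have "HLS_quotient l q \<sigma> \<noteq> \<infinity>"
    using HLS_quotient_eq[OF \<rho>(1) M(2) q i] by (auto simp: top_unique)
  \<comment> \<open>Infinite energy over a finite denominator would make the quotient
    infinite.\<close>
  then have "I_energy l \<sigma> \<noteq> \<infinity>"
    by (auto simp: HLS_quotient_def Let_def ennreal_top_divide)
  with I_energy_pos[OF adm, of l] show ?thesis
    by (cases "I_energy l \<sigma>") (auto simp: less_le)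
qed

text \<open>At equal mass the mass factor of the quotient cancels, and minimality becomes a lower
  bound on the energy by the ratio of the two other integrals.\<close>

lemma attains_HLS_const_le:
  fixes \<sigma> \<rho> :: "real^'n \<Rightarrow> real"
  assumes \<sigma>: "attains_HLS_const l q \<sigma>" "\<sigma> \<in> densities q M" and M: "0 < M"
    and q: "0 < q" "q < 1" and \<rho>: "\<rho> \<in> densities q M"
    and j: "I_energy l \<sigma> = ennreal j" "0 \<le> j" and i: "I_energy l \<rho> = ennreal i" "0 \<le> i"
  shows "j * ((LINT x|lebesgue. \<rho> x powr q) / (LINT x|lebesgue. \<sigma> x powr q)) powr (l / (real CARD('n) * (1 - q))) \<le> i"
proof -
  let ?X = "LINT x|lebesgue. \<rho> x powr q" and ?Y = "LINT x|lebesgue. \<sigma> x powr q"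
  let ?\<beta> = "l / (real CARD('n) * (1 - q))" and ?m = "M powr HLS_exponent CARD('n) l q"
  have pos: "0 < ?X" "0 < ?Y"
    using \<sigma>(2) \<rho> M by (auto intro: Lq_integral_pos densities_admissible)
  have "HLS_quotient l q \<sigma> = HLS_const TYPE('n) l q"
    using \<sigma>(1) by (simp add: attains_HLS_const_def)
  also have "\<dots> \<le> HLS_quotient l q \<rho>"
    unfolding HLS_const_def by (rule INF_lower) (rule densities_admissible[OF \<rho> M])
  finally have "j / (?m * ?Y powr ?\<beta>) \<le> i / (?m * ?X powr ?\<beta>)"
    unfolding HLS_quotient_eq[OF \<sigma>(2) M q j] HLS_quotient_eq[OF \<rho> M q i] using i by (subst (asm) ennreal_le_iff) auto
  then have "(j / ?Y powr ?\<beta>) / ?m \<le> (i / ?X powr ?\<beta>) / ?m"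
    by (simp only: divide_divide_eq_left mult.commute)
  moreover have "0 < ?m" using M by simp
  ultimately have "j / ?Y powr ?\<beta> \<le> i / ?X powr ?\<beta>"
    by (meson divide_right_mono_neg divide_strict_right_mono linorder_not_less)
  then show ?thesis
    using pos by (simp add: powr_divide field_simps)
qed

text \<open>Otherwise test densities of bounded energy and arbitrarily large integral of
  \<open>\<rho> powr q\<close> would bring the quotient below the positive value at
  \<open>\<sigma>\<close>.\<close>

lemma attains_HLS_const_imp_exponent:
  fixes \<sigma> :: "real^'n \<Rightarrow> real"
  assumes \<sigma>: "attains_HLS_const l q \<sigma>" "\<sigma> \<in> densities q M" and M: "0 < M" and l: "0 < l"
    and q: "0 < q" "q < 1"
  shows "real CARD('n) < q * (real CARD('n) + l)"
proof (rule ccontr)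
  assume "\<not> ?thesis"
  then have qN: "q * (real CARD('n) + l) \<le> real CARD('n)" by simp
  let ?Y = "LINT x|lebesgue. \<sigma> x powr q"
  define \<beta> where "\<beta> = l / (real CARD('n) * (1 - q))"
  have \<beta>: "0 < \<beta>" using l q by (simp add: \<beta>_def)
  define B where "B = 2 powr l * (4 * M * M)"
  have Y: "0 < ?Y" using \<sigma>(2) M by (auto intro: Lq_integral_pos densities_admissible)
  have B: "0 < B" using M by (simp add: B_def)
  obtain j where j: "0 < j" "I_energy l \<sigma> = ennreal j"
    using attains_HLS_const_finite[OF \<sigma>(1) _ M l q] \<sigma>(2) by (auto simp: densities_def)
  \<comment> \<open>The threshold makes the lower bound \<open>j * (X / Y) powr \<beta>\<close> for
    the energy, X and Y being the integrals for \<open>\<rho>\<close> and \<open>\<sigma>\<close>,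
    larger than the upper bound \<open>B\<close>.\<close>
  obtain \<rho> :: "real^'n \<Rightarrow> real" where \<rho>: "\<rho> \<in> densities q M" "I_energy l \<rho> \<le> ennreal B"
      "?Y * (B / j) powr (1 / \<beta>) < (LINT x|lebesgue. \<rho> x powr q)"
    using test_density_large[OF l q M qN] unfolding B_def by blast
  obtain i where i: "I_energy l \<rho> = ennreal i" "0 \<le> i" "i \<le> B"
    using \<rho>(2) B by (cases "I_energy l \<rho>") (auto simp: top_unique)
  have "(B / j) powr (1 / \<beta>) < (LINT x|lebesgue. \<rho> x powr q) / ?Y"
    using \<rho>(3) Y by (simp add: field_simps)
  then have "((B / j) powr (1 / \<beta>)) powr \<beta> < ((LINT x|lebesgue. \<rho> x powr q) / ?Y) powr \<beta>"
    using \<beta> by (intro powr_less_mono2) auto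
  moreover have "((B / j) powr (1 / \<beta>)) powr \<beta> = B / j"
    using \<beta> B j by (simp add: powr_powr)
  ultimately have "B < j * ((LINT x|lebesgue. \<rho> x powr q) / ?Y) powr \<beta>"
    using j by (simp add: field_simps)
  also have "\<dots> \<le> i"
    using attains_HLS_const_le[OF \<sigma> M q \<rho>(1) j(2) _ i(1,2)] j(1) by (simp add: \<beta>_def)
  finally show False using i by simp
qed

section \<open>Mass-preserving dilations\<close>

text \<open>In the energy the two prefactors cancel the two Jacobians and the kernel leaves
  \<open>t powr (- l)\<close>. In the integral of the power \<open>q\<close> the prefactor cancels
  the Jacobian only partly.\<close>

lemma rescale_facts:
  fixes \<rho> :: "real^'n \<Rightarrow> real"
  assumes \<rho>: "\<rho> \<in> nonneg_L1_Lq q" and t: "0 < t"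
  shows "rescale t \<rho> \<in> nonneg_L1_Lq q"
    and "(LINT x|lebesgue. rescale t \<rho> x) = (LINT x|lebesgue. \<rho> x)"
    and "(LINT x|lebesgue. rescale t \<rho> x powr q) = t powr (- (real CARD('n) * (1 - q))) * (LINT x|lebesgue. \<rho> x powr q)"
    and "I_energy l (rescale t \<rho>) = ennreal (t powr (- l)) * I_energy l \<rho>"
proof -
  note [measurable] = nonneg_L1_LqD(1)[OF \<rho>] and nn = nonneg_L1_LqD(2)[OF \<rho>]
  let ?N = "real CARD('n)"
  have resc: "rescale t \<rho> x = t powr ?N * \<rho> (t *\<^sub>R x)" for x
    using t by (simp add: rescale_def powr_realpow)
  have nn': "0 \<le> rescale t \<rho> x" for x using nn t by (simp add: rescale_def)
  have "(\<lambda>x. ennreal (\<rho> (t *\<^sub>R x))) \<in> borel_measurable lebesgue"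
    by (rule nn_integral_lebesgue_scale(2)[OF t]) measurable
  \<comment> \<open>The dilation lemma speaks of \<open>ennreal\<close> functions;
    \<open>enn2real\<close> carries measurability back to the nonnegative real function.\<close>
  then have "(\<lambda>x. enn2real (ennreal (\<rho> (t *\<^sub>R x)))) \<in> borel_measurable lebesgue"
    by measurable
  then have [measurable]: "(\<lambda>x. \<rho> (t *\<^sub>R x)) \<in> borel_measurable lebesgue"
    using nn by simp
  have meas[measurable]: "rescale t \<rho> \<in> borel_measurable lebesgue"
    unfolding rescale_def[abs_def] by measurable
  \<comment> \<open>Used for \<open>s = 1\<close>, the mass, and for \<open>s = q\<close>.\<close>
  have int: "(\<integral>\<^sup>+x. ennreal (rescale t \<rho> x powr s) \<partial>lebesgue) =
      ennreal (t powr (?N * s - ?N)) * (\<integral>\<^sup>+x. ennreal (\<rho> x powr s) \<partial>lebesgue)" for s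
  proof -
    have "(\<integral>\<^sup>+x. ennreal (rescale t \<rho> x powr s) \<partial>lebesgue) =
        (\<integral>\<^sup>+x. ennreal (t powr (?N * s)) * ennreal (\<rho> (t *\<^sub>R x) powr s) \<partial>lebesgue)"
      using nn by (intro nn_integral_cong) (simp add: resc powr_mult powr_powr ennreal_mult)
    also have "\<dots> = ennreal (t powr (?N * s)) * (\<integral>\<^sup>+x. ennreal (\<rho> (t *\<^sub>R x) powr s) \<partial>lebesgue)"
      by (rule nn_integral_cmult) measurable
    also have "(\<integral>\<^sup>+x. ennreal (\<rho> (t *\<^sub>R x) powr s) \<partial>lebesgue) = ennreal (t powr (- ?N)) * (\<integral>\<^sup>+x. ennreal (\<rho> x powr s) \<partial>lebesgue)"
      by (rule nn_integral_lebesgue_scale(1)[OF t, where f = "\<lambda>x. ennreal (\<rho> x powr s)"]) measurable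
    also have "ennreal (t powr (?N * s)) * (ennreal (t powr (- ?N)) * (\<integral>\<^sup>+x. ennreal (\<rho> x powr s) \<partial>lebesgue)) =
        ennreal (t powr (?N * s - ?N)) * (\<integral>\<^sup>+x. ennreal (\<rho> x powr s) \<partial>lebesgue)"
      by (simp add: ennreal_mult flip: mult.assoc powr_add ennreal_mult)
    finally show ?thesis .
  qed
  have int1: "(\<integral>\<^sup>+x. ennreal (rescale t \<rho> x) \<partial>lebesgue) = (\<integral>\<^sup>+x. ennreal (\<rho> x) \<partial>lebesgue)"
    using int[of 1] t nn nn' by simp
  show mem: "rescale t \<rho> \<in> nonneg_L1_Lq q"
    using meas nn' int1 int[of q] nonneg_L1_LqD(3,4)[OF \<rho>]
    by (auto simp: nonneg_L1_Lq_def Lp_fun_def simp flip: ennreal_mult)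
  show "(LINT x|lebesgue. rescale t \<rho> x) = (LINT x|lebesgue. \<rho> x)"
    using int1 nn nn' unfolding nonneg_L1_LqD(3)[OF \<rho>] nonneg_L1_LqD(3)[OF mem]
    by (subst (asm) ennreal_inj) (auto intro: integral_nonneg)
  have "ennreal (LINT x|lebesgue. rescale t \<rho> x powr q) = ennreal (t powr (- (?N * (1 - q))) * (LINT x|lebesgue. \<rho> x powr q))"
    using int[of q] unfolding nonneg_L1_LqD(4)[OF \<rho>] nonneg_L1_LqD(4)[OF mem]
    by (simp add: ennreal_mult algebra_simps)
  then show "(LINT x|lebesgue. rescale t \<rho> x powr q) = t powr (- (?N * (1 - q))) * (LINT x|lebesgue. \<rho> x powr q)"
    by (subst (asm) ennreal_inj) (auto intro: integral_nonneg)
  let ?\<Phi> = "\<lambda>\<rho> x::real^'n. \<integral>\<^sup>+y. ennreal (norm (x - y) powr l * \<rho> y) \<partial>lebesgue"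
  have pot: "?\<Phi> (rescale t \<rho>) x = ennreal (t powr (- l)) * ?\<Phi> \<rho> (t *\<^sub>R x)" for x
  proof -
    define h where "h y = ennreal (norm (t *\<^sub>R x - y) powr l * \<rho> y)" for y
    have "(\<lambda>y. norm (t *\<^sub>R x - y) powr l) \<in> borel_measurable lebesgue"
      using measurable_lebesgue_norm_powr[of "t *\<^sub>R x" l] by (simp add: norm_minus_commute)
    then have h: "h \<in> borel_measurable lebesgue" unfolding h_def[abs_def] by measurable
    have "?\<Phi> (rescale t \<rho>) x = (\<integral>\<^sup>+y. ennreal (t powr (?N - l)) * h (t *\<^sub>R y) \<partial>lebesgue)"
    proof (intro nn_integral_cong)
      fix y
      have "norm (t *\<^sub>R x - t *\<^sub>R y) powr l = t powr l * norm (x - y) powr l"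
        using t by (simp add: powr_mult flip: scaleR_diff_right)
      then show "ennreal (norm (x - y) powr l * rescale t \<rho> y) = ennreal (t powr (?N - l)) * h (t *\<^sub>R y)"
        using t nn by (simp add: h_def resc powr_diff flip: ennreal_mult)
    qed
    also have "\<dots> = ennreal (t powr (?N - l)) * (\<integral>\<^sup>+y. h (t *\<^sub>R y) \<partial>lebesgue)"
      by (rule nn_integral_cmult) (rule nn_integral_lebesgue_scale(2)[OF t h])
    also have "\<dots> = ennreal (t powr (?N - l)) * (ennreal (t powr (- ?N)) * (\<integral>\<^sup>+y. h y \<partial>lebesgue))"
      by (simp only: nn_integral_lebesgue_scale(1)[OF t h])
    also have "\<dots> = ennreal (t powr (- l)) * (\<integral>\<^sup>+y. h y \<partial>lebesgue)"
      by (simp flip: mult.assoc powr_add ennreal_mult)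
    finally show ?thesis by (simp add: h_def)
  qed
  define H where "H x = ennreal (\<rho> x) * ?\<Phi> \<rho> x" for x
  have [measurable]: "?\<Phi> \<rho> \<in> borel_measurable lebesgue"
    by (rule measurable_potential) (use nn in auto)
  have H: "H \<in> borel_measurable lebesgue" unfolding H_def[abs_def] by measurable
  have "I_energy l (rescale t \<rho>) = (\<integral>\<^sup>+x. ennreal (t powr (?N - l)) * H (t *\<^sub>R x) \<partial>lebesgue)"
  proof (subst I_energy_iterated[OF meas nn'], intro nn_integral_cong)
    fix x
    have "ennreal (rescale t \<rho> x) * (ennreal (t powr (- l)) * c) = ennreal (t powr (?N - l)) * (ennreal (\<rho> (t *\<^sub>R x)) * c)" for c
    proof -
      have "ennreal (rescale t \<rho> x) * ennreal (t powr (- l)) = ennreal (t powr (?N - l)) * ennreal (\<rho> (t *\<^sub>R x))"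
        using nn t by (simp add: resc powr_diff powr_minus field_simps flip: ennreal_mult)
      then show ?thesis by (metis mult.assoc)
    qed
    then show "ennreal (rescale t \<rho> x) * ?\<Phi> (rescale t \<rho>) x = ennreal (t powr (?N - l)) * H (t *\<^sub>R x)"
      unfolding pot H_def .
  qed
  also have "\<dots> = ennreal (t powr (?N - l)) * (\<integral>\<^sup>+x. H (t *\<^sub>R x) \<partial>lebesgue)"
    by (rule nn_integral_cmult) (rule nn_integral_lebesgue_scale(2)[OF t H])
  also have "\<dots> = ennreal (t powr (?N - l)) * (ennreal (t powr (- ?N)) * (\<integral>\<^sup>+x. H x \<partial>lebesgue))"
    by (simp only: nn_integral_lebesgue_scale(1)[OF t H])
  also have "\<dots> = ennreal (t powr (- l)) * (\<integral>\<^sup>+x. H x \<partial>lebesgue)"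
    by (simp flip: mult.assoc powr_add ennreal_mult)
  also have "(\<integral>\<^sup>+x. H x \<partial>lebesgue) = I_energy l \<rho>"
    unfolding H_def by (rule I_energy_iterated[symmetric]) (use nn in auto)
  finally show "I_energy l (rescale t \<rho>) = ennreal (t powr (- l)) * I_energy l \<rho>" .
qed

section \<open>Minimising along the dilations of the optimiser\<close>

text \<open>Bernoulli's inequality for real exponents: Young's inequality for
  \<open>x powr b\<close> and 1 with weights \<open>1 / b\<close> and \<open>1 - 1 / b\<close>,
  multiplied by \<open>b\<close>.\<close>

lemma bernoulli_powr:
  fixes x b :: real
  assumes "0 < x" "1 < b"
  shows "1 + b * (x - 1) \<le> x powr b"
proof -
  have "(x powr b) powr (1 / b) * 1 powr (1 - 1 / b) \<le> 1 / b * x powr b + (1 - 1 / b) * 1"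
    using assms by (intro Youngs_inequality_0) auto
  then have "b * x \<le> b * (1 / b * x powr b + (1 - 1 / b))"
    using assms by (intro mult_left_mono) (auto simp: powr_powr)
  also have "\<dots> = x powr b + b - 1" using assms by (simp add: algebra_simps)
  finally show ?thesis by (simp add: algebra_simps)
qed

text \<open>The last hypothesis says that \<open>s\<close> is a critical point. Bernoulli at
  \<open>t / s\<close> says that the convex power function lies above its tangent at
  \<open>s\<close>, whose slope is \<open>B\<close>.\<close>

lemma powr_minus_linear_min:
  fixes A B b s t :: real
  assumes "0 < A" "1 < b" "0 < s" "0 < t" "b * A * s powr (b - 1) = B"
  shows "A * s powr b - B * s \<le> A * t powr b - B * t"
proof -
  have "A * s powr b * (1 + b * (t / s - 1)) \<le> A * s powr b * (t / s) powr b"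
    using assms by (intro mult_left_mono bernoulli_powr) auto
  moreover have "A * s powr b * (t / s) powr b = A * t powr b"
    using assms by (simp add: powr_divide)
  moreover have "s powr b = s powr (b - 1) * s"
    using assms by (simp add: powr_diff)
  then have "A * s powr b * (b * (t / s - 1)) = (b * A * s powr (b - 1)) * (s * (t / s - 1))"
    by (simp only: mult_ac)
  then have "A * s powr b * (b * (t / s - 1)) = B * (t - s)"
    unfolding assms(5) using assms by (simp add: right_diff_distrib)
  moreover have "A * s powr b * (1 + b * (t / s - 1)) = A * s powr b + A * s powr b * (b * (t / s - 1))"
    by (simp only: distrib_left mult_1_right)
  ultimately have "A * s powr b + B * (t - s) \<le> A * t powr b" by linarith
  then show ?thesis by (simp add: algebra_simps)
qed

lemma rescaled_optimizer_minimizes: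
  fixes \<sigma> :: "real^'n \<Rightarrow> real"
  assumes l: "0 < l" and q: "0 < q" "q < 1" and M: "0 < M"
    and \<sigma>: "attains_HLS_const l q \<sigma>" "(LINT x|lebesgue. \<sigma> x) = M"
  shows "\<exists>\<tau>>0. rescale \<tau> \<sigma> \<in> densities q M \<and>
    (\<forall>\<rho>\<in>(densities q M :: (real^'n \<Rightarrow> real) set). free_energy l q (rescale \<tau> \<sigma>) \<le> free_energy l q \<rho>)"
proof -
  let ?N = "real CARD('n)"
  have \<sigma>mem: "\<sigma> \<in> nonneg_L1_Lq q"
    using \<sigma>(1) by (auto simp: attains_HLS_const_def HLS_admissible_def)
  then have \<sigma>d: "\<sigma> \<in> densities q M" using \<sigma>(2) by (simp add: densities_def)
  obtain j where j: "0 < j" "I_energy l \<sigma> = ennreal j"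
    using attains_HLS_const_finite[OF \<sigma> M l q] by blast
  define Y where "Y = (LINT x|lebesgue. \<sigma> x powr q)"
  have Y: "0 < Y" unfolding Y_def by (rule Lq_integral_pos[OF densities_admissible[OF \<sigma>d M]])
  define \<beta> where "\<beta> = l / (?N * (1 - q))"
  have \<beta>: "1 < \<beta>"
  proof -
    have "?N < q * (?N + l)" by (rule attains_HLS_const_imp_exponent[OF \<sigma>(1) \<sigma>d M l q])
    moreover have "q * l < l" using q l by simp
    ultimately have "?N * (1 - q) < l" by (simp add: algebra_simps)
    then show ?thesis using q by (simp add: \<beta>_def)
  qed
  define A where "A = j / (2 * l)"
  define B where "B = Y / (1 - q)"
  have AB: "0 < A" "0 < B" using j Y l q by (auto simp: A_def B_def)
  \<comment> \<open>The root of \<open>\<beta> * A * s powr (\<beta> - 1) = B\<close>, hence the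
    critical point of \<open>A * t powr \<beta> - B * t\<close>; it exists because
    \<open>\<beta> > 1\<close>.\<close>
  define s where "s = (B / (\<beta> * A)) powr (1 / (\<beta> - 1))"
  have s: "0 < s" using AB \<beta> by (simp add: s_def)
  have "s powr (\<beta> - 1) = B / (\<beta> * A)"
    using AB \<beta> by (simp add: s_def powr_powr)
  then have crit: "\<beta> * A * s powr (\<beta> - 1) = B" using AB \<beta> by simp
  \<comment> \<open>The dilation that multiplies the integral of \<open>\<sigma> powr q\<close> by
    exactly \<open>s\<close>; it then multiplies the energy by
    \<open>s powr \<beta>\<close>.\<close>
  define \<tau> where "\<tau> = s powr (- (1 / (?N * (1 - q))))"
  have \<tau>: "0 < \<tau>" using s by (simp add: \<tau>_def)
  have \<tau>1: "\<tau> powr (- (?N * (1 - q))) = s" using s q by (simp add: \<tau>_def powr_powr)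
  have \<tau>2: "\<tau> powr (- l) = s powr \<beta>" by (simp add: \<tau>_def powr_powr \<beta>_def)
  note resc = rescale_facts[OF \<sigma>mem \<tau>]
  have d: "rescale \<tau> \<sigma> \<in> densities q M"
    using resc(1,2) \<sigma>(2) by (simp add: densities_def)
  have "I_energy l (rescale \<tau> \<sigma>) = ennreal (s powr \<beta> * j)"
    using resc(4)[of l] j by (simp add: \<tau>2 ennreal_mult)
  then have F: "free_energy l q (rescale \<tau> \<sigma>) = ereal (A * s powr \<beta> - B * s)"
    using j resc(3)[unfolded \<tau>1, folded Y_def] free_energy_eq[of l "rescale \<tau> \<sigma>" "s powr \<beta> * j" q]
    by (simp add: A_def B_def mult.commute)
  have "free_energy l q (rescale \<tau> \<sigma>) \<le> free_energy l q \<rho>" if \<rho>: "\<rho> \<in> densities q M" for \<rho> :: "real^'n \<Rightarrow> real"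
  proof (cases "I_energy l \<rho>")
    case top
    then show ?thesis using free_energy_infinite[of l \<rho> q] l by simp
  next
    case (real i)
    define X where "X = (LINT x|lebesgue. \<rho> x powr q)"
    have X: "0 < X" unfolding X_def by (rule Lq_integral_pos[OF densities_admissible[OF \<rho> M]])
    \<comment> \<open>First the one-variable minimum at the ratio \<open>X / Y\<close>, then the
      optimality of \<open>\<sigma>\<close> to bound the energy of \<open>\<rho>\<close> from
      below.\<close>
    have "A * s powr \<beta> - B * s \<le> A * (X / Y) powr \<beta> - B * (X / Y)"
      using AB \<beta> s X Y crit by (intro powr_minus_linear_min) auto
    also have "\<dots> \<le> i / (2 * l) - X / (1 - q)"
    proof (intro diff_mono)
      have "j * (X / Y) powr \<beta> \<le> i"
        using attains_HLS_const_le[OF \<sigma>(1) \<sigma>d M q \<rho> j(2) _ real(2,1)] j by (simp add: X_def Y_def \<beta>_def)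
      then show "A * (X / Y) powr \<beta> \<le> i / (2 * l)"
        using l by (simp add: A_def divide_right_mono)
      show "X / (1 - q) \<le> B * (X / Y)" using Y by (simp add: B_def)
    qed
    finally show ?thesis
      using F free_energy_eq[OF real(2,1)] by (simp add: X_def)
  qed
  with \<tau> d show ?thesis by blast
qed

theorem corollary2:
  fixes lam q M :: real
  assumes "0 < lam" and "0 < q" and "q < 1" and "0 < M"
  shows "(bounded_from_below_on (free_energy lam q) (densities q M :: (real ^ 'n \<Rightarrow> real) set)
            \<longleftrightarrow> q > real CARD('n) / (real CARD('n) + lam)) \<and>
         (\<forall>\<rho>s :: real ^ 'n \<Rightarrow> real.
            attains_HLS_const lam q \<rho>s \<and> (LINT x|lebesgue. \<rho>s x) = M \<longrightarrow>
            (\<exists>\<tau>>0. rescale \<tau> \<rho>s \<in> densities q M \<and>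
                    (\<forall>\<rho> \<in> (densities q M :: (real ^ 'n \<Rightarrow> real) set).
                       free_energy lam q \<rho> \<ge> free_energy lam q (rescale \<tau> \<rho>s))))"
proof -
  have "q * (real CARD('n) + lam) \<le> real CARD('n)" if "\<not> q > real CARD('n) / (real CARD('n) + lam)"
    using that assms(1) by (simp add: not_less pos_le_divide_eq add_pos_pos)
  then have "bounded_from_below_on (free_energy lam q) (densities q M :: (real ^ 'n \<Rightarrow> real) set)
            \<longleftrightarrow> q > real CARD('n) / (real CARD('n) + lam)"
    using free_energy_bounded_below[where 'n = 'n, OF assms] free_energy_unbounded_below[where 'n = 'n, OF assms]
    by blast
  then show ?thesis
    using rescaled_optimizer_minimizes[where 'n = 'n, OF assms] by blast
qed

end
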